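(* There are absolute constants $C,c>0$ such that the following hold for the Propp machine on $\mathbb{Z}$. (i) For every integer $L\ge 2$ there is $M_0=M_0(L)$ such that for all integers $M\ge M_0$, every even or odd initial configuration, every time $t\in\mathbb{N}_0$ and every interval $X\subseteq\mathbb{Z}$ of length $L$, $$\frac1M\sum_{k=1}^M \mathrm{DISC}(X+k,t)^2\le C\log L .$$ (ii) For all integers $L\ge 1$ and $M\ge 1$ there exist an even initial configuration, a time $t\in\mathbb{N}_0$ and an interval $X\subseteq\mathbb{Z}$ of length $L$ such that $$\frac1M\sum_{k=1}^M \mathrm{DISC}(X+k,t)^2\ge c\log L .$$
   Context: $\mathbb{N}_0$ is the set of non-negative integers. An interval of length $L$ in $\mathbb{Z}$ is a set of $L$ consecutive integers, and $X+k=\{x+k : x\in X\}$. Propp machine on $\mathbb{Z}$: at each time $t\in\mathbb{N}_0$, each vertex $x\in\mathbb{Z}$ holds a number $f(x,t)\in\mathbb{N}_0$ of chips and an arrow $\mathrm{ARR}(x,t)\in\{-1,+1\}$ ($+1$ = right, $-1$ = left). The initial configuration (the values $f(x,0)$ and $\mathrm{ARR}(x,0)$, $x\in\mathbb{Z}$; infinitely many vertices may hold chips) determines all later configurations by $$f(x,t+1)=\tfrac12 f(x-1,t)+\tfrac12 f(x+1,t)+\tfrac12\mathrm{ARR}(x-1,t)\,(f(x-1,t)\bmod 2)-\tfrac12\mathrm{ARR}(x+1,t)\,(f(x+1,t)\bmod 2),$$ $$\mathrm{ARR}(x,t+1)=(-1)^{f(x,t)}\,\mathrm{ARR}(x,t).$$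 A configuration is even if no chip is at an odd position, and odd if no chip is at an even position (arrows are unrestricted). $E(x,t)$ is the expected number of chips at $x$ after all chips of the initial configuration perform independent simple random walks for $t$ steps, i.e. $E(x,t)=\sum_{y\in\mathbb{Z}}f(y,0)\,H(x-y,t)$ (a finite sum), where $H(z,t)=2^{-t}\binom{t}{(t+z)/2}$ if $t-z$ is even (which is $0$ if $|z|>t$) and $H(z,t)=0$ otherwise. For finite $X\subseteq\mathbb{Z}$, $\mathrm{DISC}(X,t):=\sum_{x\in X}f(x,t)-\sum_{x\in X}E(x,t)$. *)

theory Defs
  imports "HOL-Analysis.Analysis"
begin

text \<open>
  An initial configuration is a pair of functions \<open>f0\<close> (chips) and \<open>a0\<close> (arrows, \<open>1\<close> for right and
  \<open>-1\<close> for left); \<open>chips f0 a0 x t\<close> and \<open>arrow f0 a0 x t\<close> describe the vertex \<open>x\<close> at time \<open>t\<close>.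
\<close>

definition arrows :: "(int \<Rightarrow> int) \<Rightarrow> bool" where
  "arrows a0 \<longleftrightarrow> (\<forall>x. a0 x \<in> {-1, 1})"

definition even_config :: "(int \<Rightarrow> nat) \<Rightarrow> bool" where
  "even_config f0 \<longleftrightarrow> (\<forall>x. odd x \<longrightarrow> f0 x = 0)"

definition odd_config :: "(int \<Rightarrow> nat) \<Rightarrow> bool" where
  "odd_config f0 \<longleftrightarrow> (\<forall>x. even x \<longrightarrow> f0 x = 0)"

text \<open>
  For arrows in \<open>{-1, 1}\<close> the numerator below is even and non-negative, so neither \<open>div\<close> nor
  \<open>nat\<close> truncates; see \<open>chips_Suc_real\<close>.
\<close>

fun chips :: "(int \<Rightarrow> nat) \<Rightarrow> (int \<Rightarrow> int) \<Rightarrow> int \<Rightarrow> nat \<Rightarrow> nat"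
  and arrow :: "(int \<Rightarrow> nat) \<Rightarrow> (int \<Rightarrow> int) \<Rightarrow> int \<Rightarrow> nat \<Rightarrow> int" where
  "chips f0 a0 x 0 = f0 x"
| "chips f0 a0 x (Suc t) =
     nat ((int (chips f0 a0 (x - 1) t) + int (chips f0 a0 (x + 1) t)
           + arrow f0 a0 (x - 1) t * int (chips f0 a0 (x - 1) t mod 2)
           - arrow f0 a0 (x + 1) t * int (chips f0 a0 (x + 1) t mod 2)) div 2)"
| "arrow f0 a0 x 0 = a0 x"
| "arrow f0 a0 x (Suc t) = (-1) ^ chips f0 a0 x t * arrow f0 a0 x t"

lemma arrow_values:
  assumes "arrows a0"
  shows "arrow f0 a0 x t \<in> {-1, 1}"
proof (induction t)
  case 0
  show ?case using assms by (simp add: arrows_def)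
next
  case (Suc t)
  then show ?case by (cases "even (chips f0 a0 x t)") auto
qed

lemma chips_Suc_real:
  assumes "arrows a0"
  shows "real (chips f0 a0 x (Suc t)) =
           1/2 * real (chips f0 a0 (x - 1) t) + 1/2 * real (chips f0 a0 (x + 1) t)
           + 1/2 * of_int (arrow f0 a0 (x - 1) t) * real (chips f0 a0 (x - 1) t mod 2)
           - 1/2 * of_int (arrow f0 a0 (x + 1) t) * real (chips f0 a0 (x + 1) t mod 2)"
proof -
  define p where "p = chips f0 a0 (x - 1) t"
  define q where "q = chips f0 a0 (x + 1) t"
  define a where "a = arrow f0 a0 (x - 1) t"
  define b where "b = arrow f0 a0 (x + 1) t"
  define n where "n = int p + int q + a * int (p mod 2) - b * int (q mod 2)"
  have a: "a = -1 \<or> a = 1" and b: "b = -1 \<or> b = 1"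
    using arrow_values[OF assms] by (auto simp: a_def b_def)
  have "even n \<and> 0 \<le> n"
    using a b unfolding n_def
    by (elim disjE; simp add: zmod_int; presburger)
  then have "real (nat (n div 2)) = of_int n / 2"
    by (auto elim!: evenE)
  moreover have "chips f0 a0 x (Suc t) = nat (n div 2)"
    by (simp add: n_def p_def q_def a_def b_def)
  ultimately have "real (chips f0 a0 x (Suc t)) = of_int n / 2" by simp
  also have "\<dots> = 1/2 * real p + 1/2 * real q + 1/2 * of_int a * real (p mod 2)
                   - 1/2 * of_int b * real (q mod 2)"
    unfolding n_def by (simp add: field_simps)
  finally show ?thesis by (simp add: p_def q_def a_def b_def)
qed

definition H :: "int \<Rightarrow> nat \<Rightarrow> real" where
  "H z t = (if even (int t - z) \<and> \<bar>z\<bar> \<le> int t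
            then real (t choose nat ((int t + z) div 2)) / 2 ^ t else 0)"

definition expected_chips :: "(int \<Rightarrow> nat) \<Rightarrow> int \<Rightarrow> nat \<Rightarrow> real" where
  "expected_chips f0 x t = (\<Sum>\<^sub>\<infinity>y\<in>UNIV. real (f0 y) * H (x - y) t)"

lemma expected_chips_finite_sum:
  "expected_chips f0 x t = (\<Sum>y = x - int t..x + int t. real (f0 y) * H (x - y) t)"
proof -
  have "expected_chips f0 x t = (\<Sum>\<^sub>\<infinity>y\<in>{x - int t..x + int t}. real (f0 y) * H (x - y) t)"
    unfolding expected_chips_def
    by (rule infsum_cong_neutral) (auto simp: H_def)
  then show ?thesis by simp
qed

definition DISC :: "(int \<Rightarrow> nat) \<Rightarrow> (int \<Rightarrow> int) \<Rightarrow> int set \<Rightarrow> nat \<Rightarrow> real" where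
  "DISC f0 a0 X t = (\<Sum>x\<in>X. real (chips f0 a0 x t)) - (\<Sum>x\<in>X. expected_chips f0 x t)"

definition interval_of_length :: "nat \<Rightarrow> int set \<Rightarrow> bool" where
  "interval_of_length L X \<longleftrightarrow> (\<exists>a. X = {a..<a + int L})"

definition translate :: "int set \<Rightarrow> int \<Rightarrow> int set" where
  "translate X k = (\<lambda>x. x + k) ` X"

end

theory Submission
  imports Defs
begin

text \<open>
  Write \<open>P\<close> for the average over the two neighbours (\<open>avg\<close>) and \<open>D\<close> for the central difference
  (\<open>central_diff\<close>). They commute, and \<open>P\<^sup>2 - 1 = D\<^sup>2\<close>. The machine satisfies
  \<open>f(t+1) = P f(t) - D A(t)\<close>, where \<open>A(x,t)\<close> is the arrow at \<open>x\<close> if the number of chips there is odd, and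
  \<open>0\<close> otherwise. Hence \<open>f(t) - E(t) = - D G\<close> with \<open>G = (\<Sum>w<t. P\<^sup>w A(t-1-w))\<close>, and summing over an
  interval of length \<open>L\<close> leaves values of \<open>G\<close> near its two end points.

  An arrow turns exactly when the number of chips is odd, and in a configuration of fixed parity a
  vertex is occupied at every other time only. So on the occupied parity class \<open>A(s)\<close> is half the
  difference of the arrows at times \<open>s\<close> and \<open>s + 2\<close>. Summation by parts turns \<open>2 G\<close> into
  \<open>- (\<Sum>w. D\<^sup>2 P\<^sup>w \<rho>\<^sub>w)\<close> plus a bounded term, where \<open>\<rho>\<^sub>w\<close> has values in \<open>{-1, 0, 1}\<close>: it is the arrow
  configuration, run backwards in time.

  The upper bound rests on the estimate \<open>|D P\<^sup>n g| \<le> sup |g| / sqrt (n+1)\<close>. It gives that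
  \<open>D\<^sup>3 P\<^sup>w\<close> has norm \<open>O(w\<^bsup>-3/2\<^esup>)\<close>, so the terms with \<open>w \<ge> L\<^sup>2\<close> contribute \<open>O(1)\<close> to the discrepancy of an
  interval of length \<open>L\<close>, at every position. For the terms with \<open>w < L\<^sup>2\<close> second moments are taken:
  \<open>P\<close> is self-adjoint, so the inner product of \<open>D\<^sup>2 P\<^sup>v \<rho>\<^sub>v\<close> and \<open>D\<^sup>2 P\<^sup>w \<rho>\<^sub>w\<close> equals that of \<open>\<rho>\<^sub>v\<close> and
  \<open>D\<^sup>4 P\<^bsup>v+w\<^esup> \<rho>\<^sub>w\<close>, which is \<open>O(1/(v+w+1)\<^sup>2)\<close> per position. The double sum of these
  bounds over \<open>v, w < L\<^sup>2\<close> is \<open>O(log L)\<close>. As these terms only see arrows within distance \<open>L\<^sup>2 + 1\<close>,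
  averaging over \<open>M \<ge> L\<^sup>2\<close> positions loses a constant factor only.

  For the lower bound, arrows on the parity class of occupied vertices can be prescribed at will on a half
  line up to any time (\<open>arrow_forcing\<close>): adding a multiple of \<open>2\<^sup>T\<close> chips to the vertices changes no arrow up to time \<open>T\<close>
  and allows all parities at time \<open>T\<close> to be adjusted. The second moment is a convex function of the
  arrows, so one may work with real arrows in \<open>[-1, 1]\<close> and round them to signs afterwards. Cosine waves
  are eigenfunctions of \<open>P\<close>. With \<open>n = 2 (L div 2)\<close>, the wave of frequency \<open>\<pi> 3\<^sup>j / n\<close>, placed at the
  delays \<open>w\<close> between \<open>n\<^sup>2/9\<^bsup>j+1\<^esup>\<close> and \<open>n\<^sup>2/9\<^sup>j\<close>, contributes a wave of amplitude at least
  \<open>1/10\<close> to the discrepancy. There are about \<open>log L\<close> such scales \<open>j\<close>; they use disjoint sets of delays,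
  and choosing the phases one after the other makes the second moments add up.
\<close>


section \<open>Averaging and central differences on the integers\<close>

definition avg :: "(int \<Rightarrow> real) \<Rightarrow> int \<Rightarrow> real" where
  "avg g x = (g (x - 1) + g (x + 1)) / 2"

definition central_diff :: "(int \<Rightarrow> real) \<Rightarrow> int \<Rightarrow> real" where
  "central_diff g x = (g (x + 1) - g (x - 1)) / 2"

lemma avg_pow_add: "(avg ^^ w) (\<lambda>x. f x + g x) x = (avg ^^ w) f x + (avg ^^ w) g x"
  by (induction w arbitrary: x) (simp_all add: avg_def field_simps)

lemma avg_pow_diff: "(avg ^^ w) (\<lambda>x. f x - g x) x = (avg ^^ w) f x - (avg ^^ w) g x"
  by (induction w arbitrary: x) (simp_all add: avg_def add_divide_distrib diff_divide_distrib)

lemma avg_pow_cmult: "(avg ^^ w) (\<lambda>x. c * g x) x = c * (avg ^^ w) g x"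
  by (induction w arbitrary: x) (simp_all add: avg_def field_simps)

lemma central_diff_sum: "central_diff (\<lambda>x. \<Sum>i\<in>I. f i x) x = (\<Sum>i\<in>I. central_diff (f i) x)"
  by (simp add: central_diff_def sum_subtractf flip: sum_divide_distrib)

lemma central_diff_avg: "central_diff (avg g) = avg (central_diff g)"
  by (auto simp: central_diff_def avg_def field_simps)

lemma avg_pow_Suc: "(avg ^^ Suc w) g = (avg ^^ w) (avg g)"
  by (simp add: funpow_swap1)

lemma central_diff_avg_pow: "central_diff ((avg ^^ w) g) = (avg ^^ w) (central_diff g)"
  by (induction w) (simp_all add: central_diff_avg)

lemma central_diff_pow_avg_pow: "(central_diff ^^ k) ((avg ^^ w) g) = (avg ^^ w) ((central_diff ^^ k) g)"
  by (induction k) (simp_all add: central_diff_avg_pow)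

lemma central_diff_central_diff: "central_diff (central_diff g) x = avg (avg g) x - g x"
  by (simp add: central_diff_def avg_def field_simps)

lemma avg_pow_mono:
  assumes "\<And>y. f y \<le> g y"
  shows "(avg ^^ w) f x \<le> (avg ^^ w) g x"
proof (induction w arbitrary: x)
  case (Suc w)
  show ?case using Suc[of "x - 1"] Suc[of "x + 1"] by (simp add: avg_def)
qed (use assms in auto)

lemma avg_pow_const: "(avg ^^ w) (\<lambda>_. c) x = c"
  by (induction w arbitrary: x) (simp_all add: avg_def)

lemma avg_pow_bound:
  assumes "\<And>y. \<bar>g y\<bar> \<le> B"
  shows "\<bar>(avg ^^ w) g x\<bar> \<le> B"
proof -
  have "(avg ^^ w) g x \<le> (avg ^^ w) (\<lambda>_. B) x" "(avg ^^ w) (\<lambda>_. - B) x \<le> (avg ^^ w) g x"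
    by (intro avg_pow_mono; use assms in \<open>auto simp: abs_le_iff minus_le_iff\<close>)+
  then show ?thesis by (simp add: avg_pow_const abs_le_iff)
qed

text \<open>
  The \<open>w\<close>-fold average at \<open>x\<close> depends only on the positions that a walk of \<open>w\<close> steps from \<open>x\<close> can reach;
  the parity of these positions is what makes checkerboard patterns tractable later.
\<close>

lemma avg_pow_cong:
  assumes "\<And>y. \<bar>y - x\<bar> \<le> int w \<Longrightarrow> even (y - x - int w) \<Longrightarrow> f y = g y"
  shows "(avg ^^ w) f x = (avg ^^ w) g x"
  using assms
proof (induction w arbitrary: x)
  case (Suc w)
  have "(avg ^^ w) f (x - 1) = (avg ^^ w) g (x - 1)" "(avg ^^ w) f (x + 1) = (avg ^^ w) g (x + 1)"
    by (intro Suc.IH Suc.prems; simp; presburger)+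
  then show ?case by (simp add: avg_def[of _ x])
qed simp

text \<open>
  This is the commutator relation \<open>[P\<^bsup>n+1\<^esup>, X] = (n+1) D P\<^sup>n\<close> for the position operator \<open>X\<close>; it follows
  from \<open>[P, X] = D\<close> since \<open>D\<close> commutes with \<open>P\<close>. It trades a difference for a moment of the walk.
\<close>

lemma avg_pow_position:
  "(avg ^^ Suc n) (\<lambda>y. of_int (y - x) * g y) z
     = of_int (z - x) * (avg ^^ Suc n) g z + real (Suc n) * central_diff ((avg ^^ n) g) z"
proof (induction n arbitrary: z)
  case 0
  show ?case by (simp add: avg_def central_diff_def field_simps)
next
  case (Suc n)
  have "(avg ^^ Suc (Suc n)) (\<lambda>y. of_int (y - x) * g y) z
      = avg ((avg ^^ Suc n) (\<lambda>y. of_int (y - x) * g y)) z" by simp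
  also have "\<dots> = avg (\<lambda>z. of_int (z - x) * (avg ^^ Suc n) g z + real (Suc n) * central_diff ((avg ^^ n) g) z) z"
    by (rule arg_cong[of _ _ "\<lambda>h. avg h z"], rule ext, rule Suc)
  also have "\<dots> = of_int (z - x) * avg ((avg ^^ Suc n) g) z + central_diff ((avg ^^ Suc n) g) z
                   + real (Suc n) * avg (central_diff ((avg ^^ n) g)) z"
    unfolding avg_def[of _ z] central_diff_def[of "(avg ^^ Suc n) g" z] by (simp add: field_simps del: funpow.simps)
  also have "avg (central_diff ((avg ^^ n) g)) z = central_diff ((avg ^^ Suc n) g) z"
    by (simp add: central_diff_avg)
  finally show ?case by (simp add: algebra_simps)
qed

lemma avg_pow_square: "(avg ^^ n) (\<lambda>y. (of_int (y - x))\<^sup>2) z = (of_int (z - x))\<^sup>2 + real n"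
proof (induction n arbitrary: z)
  case (Suc n)
  show ?case
    by (simp only: funpow.simps o_apply avg_def[of _ z] Suc)
       (simp add: field_simps power2_eq_square)
qed simp

text \<open>
  By the commutator relation, with \<open>X\<close> centred at \<open>x\<close>, \<open>(n+1) D P\<^sup>n g\<close> is the mean of \<open>z g\<close>, \<open>z\<close> being
  the displacement of a walk of \<open>n+1\<close> steps. The mean of \<open>|z|\<close> is at most \<open>sqrt (n+1)\<close>, because that of
  \<open>z\<^sup>2\<close> is \<open>n+1\<close>.
\<close>

lemma central_diff_avg_pow_bound:
  assumes B: "\<And>y. \<bar>g y\<bar> \<le> B"
  shows "\<bar>central_diff ((avg ^^ n) g) x\<bar> \<le> B / sqrt (real n + 1)"
proof -
  define r where "r = sqrt (real n + 1)"
  have r: "r > 0" "r\<^sup>2 = real n + 1" by (auto simp: r_def)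
  have B0: "B \<ge> 0" using B[of 0] by linarith
  \<comment> \<open>The inequality \<open>|z| \<le> (z\<^sup>2/r + r)/2\<close> replaces Cauchy-Schwarz: the mean of the right-hand side is \<open>r\<close>.\<close>
  define q where "q y = B * ((of_int (y - x))\<^sup>2 / r + r) / 2" for y
  have dom: "\<bar>of_int (y - x) * g y\<bar> \<le> q y" for y
  proof -
    define z where "z = \<bar>real_of_int (y - x)\<bar>"
    have "0 \<le> (z - r)\<^sup>2" by simp
    then have "2 * z * r \<le> z\<^sup>2 + r\<^sup>2" by (simp add: power2_diff algebra_simps)
    then have "z \<le> (z\<^sup>2 / r + r) / 2" using r(1) by (simp add: field_simps power2_eq_square)
    then have "z * \<bar>g y\<bar> \<le> (z\<^sup>2 / r + r) / 2 * B"
      using B[of y] r(1) by (intro mult_mono) (auto simp: z_def)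
    then show ?thesis by (simp add: q_def z_def abs_mult mult.commute)
  qed
  have q_avg: "(avg ^^ Suc n) q x = B * r"
  proof -
    have "q = (\<lambda>y. B / (2 * r) * (of_int (y - x))\<^sup>2 + B * r / 2)"
      using r(1) by (auto simp: q_def field_simps)
    then have "(avg ^^ Suc n) q x = B / (2 * r) * (real n + 1) + B * r / 2"
      by (simp only: avg_pow_add avg_pow_cmult avg_pow_square avg_pow_const) simp
    also have "\<dots> = B * r" using r(1) unfolding r(2)[symmetric] by (simp add: field_simps power2_eq_square)
    finally show ?thesis .
  qed
  have "(real n + 1) * central_diff ((avg ^^ n) g) x = (avg ^^ Suc n) (\<lambda>y. of_int (y - x) * g y) x"
    using avg_pow_position[of n x g x] by (simp del: funpow.simps)
  moreover have "(avg ^^ Suc n) (\<lambda>y. of_int (y - x) * g y) x \<le> B * r"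
    unfolding q_avg[symmetric] by (rule avg_pow_mono) (use dom in \<open>auto simp: abs_le_iff\<close>)
  moreover have "- (B * r) \<le> (avg ^^ Suc n) (\<lambda>y. of_int (y - x) * g y) x"
  proof -
    have "(avg ^^ Suc n) (\<lambda>y. (- 1) * q y) x \<le> (avg ^^ Suc n) (\<lambda>y. of_int (y - x) * g y) x"
      by (rule avg_pow_mono) (use dom in \<open>auto simp: abs_le_iff minus_le_iff\<close>)
    then show ?thesis unfolding avg_pow_cmult q_avg by simp
  qed
  ultimately have "\<bar>r\<^sup>2 * central_diff ((avg ^^ n) g) x\<bar> \<le> B * r"
    unfolding r(2) by linarith
  then have "r * (r * \<bar>central_diff ((avg ^^ n) g) x\<bar>) \<le> r * B"
    by (simp add: abs_mult power2_eq_square ac_simps)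
  then have "r * \<bar>central_diff ((avg ^^ n) g) x\<bar> \<le> B" using r(1) by simp
  then show ?thesis using r(1) by (simp add: r_def field_simps)
qed

text \<open>
  Each difference is paired with its own block of \<open>m\<close> averaging steps and gains a factor \<open>1 / sqrt (m+1)\<close>.
\<close>

lemma central_diff_pow_avg_pow_bound:
  assumes "\<And>y. \<bar>g y\<bar> \<le> B" and "k * m \<le> w"
  shows "\<bar>(central_diff ^^ k) ((avg ^^ w) g) x\<bar> \<le> B / sqrt (real m + 1) ^ k"
  using assms(2)
proof (induction k arbitrary: w x)
  case 0
  show ?case using avg_pow_bound[OF assms(1)] by simp
next
  case (Suc k)
  then have w: "w = m + (w - m)" and "k * m \<le> w - m" by auto
  have "(central_diff ^^ Suc k) ((avg ^^ w) g) = central_diff ((avg ^^ m) ((central_diff ^^ k) ((avg ^^ (w - m)) g)))"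
    by (subst w, subst funpow_add) (simp add: central_diff_pow_avg_pow)
  moreover have "\<bar>central_diff ((avg ^^ m) ((central_diff ^^ k) ((avg ^^ (w - m)) g))) x\<bar>
      \<le> (B / sqrt (real m + 1) ^ k) / sqrt (real m + 1)"
    by (rule central_diff_avg_pow_bound) (rule Suc.IH[OF \<open>k * m \<le> w - m\<close>])
  ultimately show ?case by (simp add: mult.commute)
qed

lemma central_diff4_bound:
  assumes "\<And>y. \<bar>g y\<bar> \<le> 1"
  shows "\<bar>(central_diff ^^ 4) ((avg ^^ w) g) x\<bar> \<le> 16 / (real w + 1)\<^sup>2"
proof -
  define m where "m = w div 4"
  have "\<bar>(central_diff ^^ 4) ((avg ^^ w) g) x\<bar> \<le> 1 / sqrt (real m + 1) ^ 4"
    by (rule central_diff_pow_avg_pow_bound) (auto simp: assms m_def)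
  also have "sqrt (real m + 1) ^ 4 = (real m + 1)\<^sup>2"
    using power_mult[of "sqrt (real m + 1)" 2 2] by simp
  also have "1 / (real m + 1)\<^sup>2 \<le> 1 / ((real w + 1) / 4)\<^sup>2"
  proof -
    have "w \<le> 4 * m + 3" by (simp add: m_def)
    then have "real w \<le> real (4 * m + 3)" by (simp only: of_nat_le_iff)
    then have "(real w + 1) / 4 \<le> real m + 1" by simp
    then show ?thesis by (intro divide_left_mono power_mono) auto
  qed
  finally show ?thesis by (simp add: power_divide)
qed

lemma central_diff3_bound:
  assumes "\<And>y. \<bar>g y\<bar> \<le> 1"
  shows "\<bar>(central_diff ^^ 3) ((avg ^^ w) g) x\<bar> \<le> 6 / ((real w + 1) * sqrt (real w + 1))"
proof -
  define m where "m = w div 3"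
  have "w \<le> 3 * m + 2" by (simp add: m_def)
  then have "real w \<le> real (3 * m + 2)" by (simp only: of_nat_le_iff)
  then have m: "(real w + 1) / 3 \<le> real m + 1" by simp
  have "\<bar>(central_diff ^^ 3) ((avg ^^ w) g) x\<bar> \<le> 1 / sqrt (real m + 1) ^ 3"
    by (rule central_diff_pow_avg_pow_bound) (auto simp: assms m_def)
  also have "\<dots> \<le> 1 / sqrt ((real w + 1) / 3) ^ 3"
    using m by (intro divide_left_mono power_mono) (auto intro!: mult_pos_pos)
  also have "sqrt ((real w + 1) / 3) ^ 3 = (real w + 1) * sqrt (real w + 1) / (3 * sqrt 3)"
    by (simp add: real_sqrt_divide power3_eq_cube)
  also have "1 / \<dots> = 3 * sqrt 3 / ((real w + 1) * sqrt (real w + 1))" by simp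
  also have "\<dots> \<le> 6 / ((real w + 1) * sqrt (real w + 1))"
    by (intro divide_right_mono) (auto intro!: real_le_lsqrt)
  finally show ?thesis .
qed

section \<open>Orthogonality of the second differences\<close>

text \<open>
  Summation by parts on a range that contains the support of \<open>f\<close> in its interior, so that no boundary
  terms appear.
\<close>

lemma sum_avg_self_adjoint:
  assumes "\<And>x. \<bar>x\<bar> \<ge> K \<Longrightarrow> f x = 0"
  shows "(\<Sum>x\<in>{-K..K}. avg f x * g x) = (\<Sum>x\<in>{-K..K}. f x * avg g x)"
    and "(\<Sum>x\<in>{-K..K}. central_diff f x * g x) = - (\<Sum>x\<in>{-K..K}. f x * central_diff g x)"
proof -
  have 1: "(\<Sum>x\<in>{-K..K}. f (x - 1) * g x) = (\<Sum>x\<in>{-K..K}. f x * g (x + 1))"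
    by (rule sum.reindex_bij_witness_not_neutral[where S' = "{-K}" and T' = "{K}"
          and i = "\<lambda>x. x + 1" and j = "\<lambda>x. x - 1"]) (use assms in auto)
  have 2: "(\<Sum>x\<in>{-K..K}. f (x + 1) * g x) = (\<Sum>x\<in>{-K..K}. f x * g (x - 1))"
    by (rule sum.reindex_bij_witness_not_neutral[where S' = "{K}" and T' = "{-K}"
          and i = "\<lambda>x. x - 1" and j = "\<lambda>x. x + 1"]) (use assms in auto)
  show "(\<Sum>x\<in>{-K..K}. avg f x * g x) = (\<Sum>x\<in>{-K..K}. f x * avg g x)"
    using 1 2 by (simp add: avg_def distrib_left distrib_right sum.distrib flip: sum_divide_distrib)
  show "(\<Sum>x\<in>{-K..K}. central_diff f x * g x) = - (\<Sum>x\<in>{-K..K}. f x * central_diff g x)"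
    using 1 2 by (simp add: central_diff_def left_diff_distrib right_diff_distrib sum_subtractf diff_divide_distrib flip: sum_divide_distrib)
qed

lemma avg_pow_eq_0:
  assumes "\<And>y. \<bar>y\<bar> \<ge> B \<Longrightarrow> f y = 0" and "\<bar>x\<bar> \<ge> B + int w"
  shows "(avg ^^ w) f x = 0"
proof -
  have "(avg ^^ w) f x = (avg ^^ w) (\<lambda>_. 0) x"
    by (rule avg_pow_cong) (use assms in auto)
  then show ?thesis by (simp add: avg_pow_const)
qed

lemma sum_avg_pow_self_adjoint:
  assumes "\<And>x. \<bar>x\<bar> \<ge> B \<Longrightarrow> f x = 0" and "B + int w \<le> K"
  shows "(\<Sum>x\<in>{-K..K}. (avg ^^ w) f x * g x) = (\<Sum>x\<in>{-K..K}. f x * (avg ^^ w) g x)"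
  using assms(2)
proof (induction w arbitrary: g)
  case (Suc w)
  have "(\<Sum>x\<in>{-K..K}. (avg ^^ Suc w) f x * g x) = (\<Sum>x\<in>{-K..K}. (avg ^^ w) f x * avg g x)"
    unfolding funpow.simps o_apply
    by (rule sum_avg_self_adjoint) (use Suc.prems in \<open>auto intro!: avg_pow_eq_0[OF assms(1)]\<close>)
  then show ?case using Suc by (simp add: avg_pow_Suc del: funpow.simps)
qed simp

text \<open>
  This is where delays decouple: self-adjointness moves all operators to one side, where the \<open>w + v\<close> averaging steps
  act together against four differences.
\<close>

lemma second_difference_inner:
  assumes "\<And>x. \<bar>x\<bar> \<ge> B \<Longrightarrow> f x = 0" and "B + int w + 2 \<le> K"
  shows "(\<Sum>x\<in>{-K..K}. central_diff (central_diff ((avg ^^ w) f)) x * central_diff (central_diff ((avg ^^ v) g)) x)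
       = (\<Sum>x\<in>{-K..K}. f x * (central_diff ^^ 4) ((avg ^^ (w + v)) g) x)"
proof -
  have z: "(avg ^^ w) f x = 0" if "\<bar>x\<bar> \<ge> B + int w" for x
    by (rule avg_pow_eq_0[OF assms(1) that])
  have 4: "(central_diff ^^ 4) h = central_diff (central_diff (central_diff (central_diff h)))" for h
    by (simp add: eval_nat_numeral)
  have "(\<Sum>x\<in>{-K..K}. central_diff (central_diff ((avg ^^ w) f)) x * central_diff (central_diff ((avg ^^ v) g)) x)
     = - (\<Sum>x\<in>{-K..K}. central_diff ((avg ^^ w) f) x * central_diff (central_diff (central_diff ((avg ^^ v) g))) x)"
    by (rule sum_avg_self_adjoint) (use assms(2) in \<open>auto simp: central_diff_def z\<close>)
  also have "\<dots> = (\<Sum>x\<in>{-K..K}. (avg ^^ w) f x * (central_diff ^^ 4) ((avg ^^ v) g) x)"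
    by (subst sum_avg_self_adjoint) (use assms(2) in \<open>auto simp: z 4\<close>)
  also have "\<dots> = (\<Sum>x\<in>{-K..K}. f x * (avg ^^ w) ((central_diff ^^ 4) ((avg ^^ v) g)) x)"
    by (rule sum_avg_pow_self_adjoint[OF assms(1)]) (use assms(2) in auto)
  finally show ?thesis
    by (simp only: central_diff_pow_avg_pow funpow_add o_apply)
qed

lemma sum_inverse_le_ln:
  "n \<ge> 1 \<Longrightarrow> (\<Sum>w<n. 1 / (real w + 1)) \<le> 1 + ln (real n)"
proof (induction n rule: nat_induct_at_least)
  case (Suc n)
  have "ln (real n / (real n + 1)) \<le> real n / (real n + 1) - 1"
    using Suc by (intro ln_le_minus_one) auto
  also have "\<dots> = - 1 / (real n + 1)" by (simp add: field_simps)
  finally have "ln (real n) - ln (real n + 1) \<le> - (1 / (real n + 1))"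
    using Suc.hyps by (simp add: ln_div)
  then have "1 / (real n + 1) \<le> ln (real (Suc n)) - ln (real n)"
    by (simp add: add.commute)
  then show ?case using Suc.IH by simp
qed simp

lemma sum_inverse_square_le:
  "(\<Sum>v<n. 1 / (real w + real v + 1)\<^sup>2) \<le> 2 / (real w + 1)"
proof (cases n)
  case (Suc m)
  have "(\<Sum>v<Suc m. 1 / (real w + real v + 1)\<^sup>2) \<le> 2 / (real w + 1) - 1 / (real w + real m + 1)"
  proof (induction m)
    case 0
    show ?case by (simp add: divide_simps power2_eq_square)
  next
    case (Suc m)
    define q where "q = real w + real m + 1"
    have q: "q \<ge> 1" by (simp add: q_def)
    have "1 / (q + 1)\<^sup>2 \<le> 1 / (q * (q + 1))"
      using q by (intro divide_left_mono) (auto simp: power2_eq_square)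
    also have "\<dots> = 1 / q - 1 / (q + 1)" using q by (simp add: field_simps)
    finally have "1 / (real w + real (Suc m) + 1)\<^sup>2 \<le> 1 / (real w + real m + 1) - 1 / (real w + real (Suc m) + 1)"
      by (simp add: q_def add_ac)
    then show ?case using Suc by (simp only: sum.lessThan_Suc)
  qed
  moreover have "0 \<le> 1 / (real w + real m + 1)" by simp
  ultimately show ?thesis unfolding Suc by linarith
qed simp

text \<open>
  The square is expanded into inner products of pairs of delays. A window of length \<open>M\<close> sees only arrows in its
  neighbourhood \<open>J\<close>, so \<open>\<rho>\<close> may be cut off outside \<open>J\<close>. After that, all sums range over a box large enough for
  \<open>second_difference_inner\<close>, and each pair of delays costs \<open>16/(w+v+1)\<^sup>2\<close> per position of \<open>J\<close>.
\<close>

lemma near_part_second_moment: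
  fixes \<rho> :: "nat \<Rightarrow> int \<Rightarrow> real"
  assumes \<rho>: "\<And>w y. \<bar>\<rho> w y\<bar> \<le> 1" and n: "n \<ge> 1"
  shows "(\<Sum>k=1..M. (\<Sum>w<n. central_diff (central_diff ((avg ^^ w) (\<rho> w))) (b + int k))\<^sup>2)
           \<le> 32 * (real M + 2 * real n + 2) * (1 + ln (real n))"
proof -
  define J where "J = {b - int n .. b + int M + int n + 1}"
  define f where "f w y = (if y \<in> J then \<rho> w y else 0)" for w y
  define B where "B = \<bar>b\<bar> + int M + int n + 2"
  define K where "K = B + int n + 2"
  define u where "u w x = central_diff (central_diff ((avg ^^ w) (f w))) x" for w x
  have f0: "f w y = 0" if "\<bar>y\<bar> \<ge> B" for w y
    using that by (auto simp: f_def J_def B_def)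
  have f1: "\<bar>f w y\<bar> \<le> 1" for w y
    using \<rho> by (simp add: f_def)
  have local: "central_diff (central_diff ((avg ^^ w) (\<rho> w))) (b + int k) = u w (b + int k)"
    if "w < n" "k \<in> {1..M}" for w k
  proof -
    have "(avg ^^ w) (\<rho> w) y = (avg ^^ w) (f w) y" if "\<bar>y - (b + int k)\<bar> \<le> 2" for y
      by (rule avg_pow_cong) (use that \<open>w < n\<close> \<open>k \<in> _\<close> in \<open>auto simp: f_def J_def\<close>)
    then show ?thesis by (simp add: u_def central_diff_def)
  qed
  have inner: "(\<Sum>x\<in>{-K..K}. u w x * u v x) \<le> (real M + 2 * real n + 2) * (16 / (real w + real v + 1)\<^sup>2)"
    if "w < n" "v < n" for w v
  proof -
    have "(\<Sum>x\<in>{-K..K}. u w x * u v x)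
        = (\<Sum>x\<in>{-K..K}. f w x * (central_diff ^^ 4) ((avg ^^ (w + v)) (f v)) x)"
      unfolding u_def by (rule second_difference_inner[OF f0]) (use that in \<open>auto simp: K_def\<close>)
    also have "\<dots> = (\<Sum>x\<in>J. f w x * (central_diff ^^ 4) ((avg ^^ (w + v)) (f v)) x)"
      by (rule sum.mono_neutral_right) (auto simp: f_def J_def K_def B_def)
    also have "\<dots> \<le> (\<Sum>x\<in>J. 16 / (real w + real v + 1)\<^sup>2)"
    proof (rule sum_mono)
      fix x
      have "\<bar>f w x * (central_diff ^^ 4) ((avg ^^ (w + v)) (f v)) x\<bar> \<le> 1 * (16 / (real (w + v) + 1)\<^sup>2)"
        unfolding abs_mult by (intro mult_mono f1 central_diff4_bound) auto
      then show "f w x * (central_diff ^^ 4) ((avg ^^ (w + v)) (f v)) x \<le> 16 / (real w + real v + 1)\<^sup>2"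
        by (simp add: abs_le_iff)
    qed
    also have "\<dots> = (real M + 2 * real n + 2) * (16 / (real w + real v + 1)\<^sup>2)"
      by (simp add: J_def)
    finally show ?thesis .
  qed
  have "(\<Sum>k=1..M. (\<Sum>w<n. central_diff (central_diff ((avg ^^ w) (\<rho> w))) (b + int k))\<^sup>2)
      = (\<Sum>k=1..M. (\<Sum>w<n. u w (b + int k))\<^sup>2)"
    by (intro sum.cong refl arg_cong[of _ _ "\<lambda>z. z\<^sup>2"]) (auto intro: local)
  also have "\<dots> = (\<Sum>x\<in>(\<lambda>k. b + int k) ` {1..M}. (\<Sum>w<n. u w x)\<^sup>2)"
    by (subst sum.reindex) (auto simp: inj_on_def)
  also have "\<dots> \<le> (\<Sum>x\<in>{-K..K}. (\<Sum>w<n. u w x)\<^sup>2)"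
    by (rule sum_mono2) (auto simp: K_def B_def)
  also have "\<dots> = (\<Sum>x\<in>{-K..K}. \<Sum>w<n. \<Sum>v<n. u w x * u v x)"
    by (simp add: power2_eq_square sum_product)
  also have "\<dots> = (\<Sum>w<n. \<Sum>v<n. \<Sum>x\<in>{-K..K}. u w x * u v x)"
    by (subst sum.swap, rule sum.cong[OF refl], rule sum.swap)
  also have "\<dots> \<le> (\<Sum>w<n. \<Sum>v<n. (real M + 2 * real n + 2) * (16 / (real w + real v + 1)\<^sup>2))"
    by (intro sum_mono inner) auto
  also have "\<dots> = 16 * (real M + 2 * real n + 2) * (\<Sum>w<n. \<Sum>v<n. 1 / (real w + real v + 1)\<^sup>2)"
    unfolding sum_distrib_left by (intro sum.cong refl) simp
  also have "\<dots> \<le> 16 * (real M + 2 * real n + 2) * (\<Sum>w<n. 2 / (real w + 1))"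
    by (intro mult_left_mono sum_mono sum_inverse_square_le) auto
  also have "(\<Sum>w<n. 2 / (real w + 1)) = 2 * (\<Sum>w<n. 1 / (real w + 1))"
    by (simp add: sum_distrib_left)
  also have "16 * (real M + 2 * real n + 2) * \<dots> \<le> 16 * (real M + 2 * real n + 2) * (2 * (1 + ln (real n)))"
    using sum_inverse_le_ln[OF n] by (intro mult_left_mono) auto
  finally show ?thesis by (simp add: algebra_simps)
qed

lemma sum_inverse_three_halves_le:
  assumes "n \<ge> 1"
  shows "(\<Sum>w\<in>{n..<n+t}. 1 / ((real w + 1) * sqrt (real w + 1))) \<le> 2 / sqrt (real n)"
proof -
  have "(\<Sum>w\<in>{n..<n+t}. 1 / ((real w + 1) * sqrt (real w + 1))) \<le> 2 / sqrt (real n) - 2 / sqrt (real (n + t))"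
  proof (induction t)
    case (Suc t)
    define p where "p = sqrt (real (n + t))"
    define q where "q = sqrt (real (n + t) + 1)"
    have pq: "p > 0" "q > 0" "p \<le> q" "q\<^sup>2 = p\<^sup>2 + 1" using assms by (auto simp: p_def q_def)
    have "1 / (q\<^sup>2 * q) \<le> 2 / p - 2 / q"
    proof -
      have "(q - p) * (q + p) = 1" using pq(4) by (simp add: algebra_simps power2_eq_square)
      then have qp: "q - p = 1 / (q + p)" using pq by (simp add: field_simps)
      have "2 / p - 2 / q = 2 * (q - p) / (p * q)" using pq by (simp add: field_simps)
      also have "\<dots> = 2 / ((q + p) * (p * q))" by (simp add: qp)
      also have "\<dots> \<ge> 2 / ((q + q) * (q * q))"
        using pq by (intro divide_left_mono mult_mono add_mono) (auto intro!: mult_pos_pos)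
      also have "2 / ((q + q) * (q * q)) = 1 / (q\<^sup>2 * q)" using pq(2) by (simp add: field_simps power2_eq_square)
      finally show ?thesis .
    qed
    moreover have "q\<^sup>2 = real (n + t) + 1" by (simp add: q_def)
    ultimately have "1 / ((real (n + t) + 1) * sqrt (real (n + t) + 1)) \<le> 2 / sqrt (real (n + t)) - 2 / sqrt (real (n + Suc t))"
      by (simp add: p_def q_def add_ac)
    then show ?case using Suc by simp
  qed simp
  moreover have "0 \<le> 2 / sqrt (real (n + t))" by simp
  ultimately show ?thesis by linarith
qed

section \<open>The discrepancy in terms of the arrows\<close>

lemma H_binomial: "H (2 * int k - int t) t = real (t choose k) / 2 ^ t"
  by (cases "k \<le> t") (auto simp: H_def binomial_eq_0)

lemma H_eq_0: "odd (int t - z) \<or> \<bar>z\<bar> > int t \<Longrightarrow> H z t = 0"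
  by (auto simp: H_def)

lemma H_Suc: "H z (Suc t) = (H (z - 1) t + H (z + 1) t) / 2"
proof (cases "odd (int (Suc t) - z) \<or> \<bar>z\<bar> > int (Suc t)")
  case True
  then show ?thesis by (subst (1 2 3) H_eq_0) auto
next
  case False
  define k where "k = nat ((int (Suc t) + z) div 2)"
  have z: "z = 2 * int k - int (Suc t)"
    using False by (auto simp: k_def)
  have r: "H (z + 1) t = real (t choose k) / 2 ^ t"
    using H_binomial[of k t] by (simp add: z)
  have "H z (Suc t) = real (Suc t choose k) / 2 ^ Suc t"
    using H_binomial[of k "Suc t"] by (simp add: z)
  moreover have "H (z - 1) t = real (if k = 0 then 0 else t choose (k - 1)) / 2 ^ t"
  proof (cases k)
    case 0
    then show ?thesis by (auto simp: z H_eq_0)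
  next
    case (Suc j)
    have "z - 1 = 2 * int j - int t" by (simp add: z Suc)
    then show ?thesis using H_binomial[of j t] Suc by simp
  qed
  ultimately show ?thesis
    by (simp only: r) (cases k; simp add: field_simps)
qed

lemma expected_chips_avg_pow: "expected_chips f0 x t = (avg ^^ t) (\<lambda>y. real (f0 y)) x"
proof (induction t arbitrary: x)
  case 0
  show ?case by (simp add: expected_chips_finite_sum H_def)
next
  case (Suc t)
  define S where "S = {x - int t - 1..x + int t + 1}"
  have E: "expected_chips f0 z t = (\<Sum>y\<in>S. real (f0 y) * H (z - y) t)" if "\<bar>z - x\<bar> \<le> 1" for z
    unfolding expected_chips_finite_sum
    by (rule sum.mono_neutral_left) (use that in \<open>auto simp: S_def H_eq_0\<close>)
  have "expected_chips f0 x (Suc t) = (\<Sum>y\<in>S. real (f0 y) * H (x - y) (Suc t))"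
    unfolding expected_chips_finite_sum S_def by (rule sum.cong) auto
  also have "\<dots> = (expected_chips f0 (x - 1) t + expected_chips f0 (x + 1) t) / 2"
    by (simp add: E H_Suc sum.distrib algebra_simps flip: sum_divide_distrib)
  finally show ?case by (simp add: Suc avg_def)
qed

text \<open>
  Even configurations (\<open>e = 0\<close>) and odd ones (\<open>e = 1\<close>) are treated together.
\<close>

definition parity_config :: "int \<Rightarrow> (int \<Rightarrow> nat) \<Rightarrow> bool" where
  "parity_config e f0 \<longleftrightarrow> (\<forall>x. odd (x - e) \<longrightarrow> f0 x = 0)"

lemma chips_parity:
  assumes "parity_config e f0" and "odd (x - int s - e)"
  shows "chips f0 a0 x s = 0"
  using assms(2)
proof (induction s arbitrary: x)
  case (Suc s)
  have "odd (x - 1 - int s - e)" "odd (x + 1 - int s - e)" using Suc.prems by auto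
  then show ?case by (simp add: Suc.IH)
qed (use assms(1) in \<open>auto simp: parity_config_def\<close>)

text \<open>
  The number of chips that \<open>y\<close> sends to the right, minus the number that it sends to the left.
\<close>

definition flow :: "(int \<Rightarrow> nat) \<Rightarrow> (int \<Rightarrow> int) \<Rightarrow> nat \<Rightarrow> int \<Rightarrow> real" where
  "flow f0 a0 s y = of_int (arrow f0 a0 y s) * real (chips f0 a0 y s mod 2)"

text \<open>
  The arrows on the parity class that can be occupied at time \<open>s\<close>.
\<close>

definition active_arrow :: "int \<Rightarrow> (int \<Rightarrow> nat) \<Rightarrow> (int \<Rightarrow> int) \<Rightarrow> nat \<Rightarrow> int \<Rightarrow> real" where
  "active_arrow e f0 a0 s y = (if even (y - int s - e) then of_int (arrow f0 a0 y s) else 0)"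

text \<open>
  The arrow at an occupied vertex turns if and only if \<open>flow\<close> is nonzero there, and it does not turn in the next
  step, when the vertex is empty. Hence \<open>flow\<close> telescopes in time along each parity class.
\<close>

lemma flow_eq_arrow_diff:
  assumes "parity_config e f0"
  shows "flow f0 a0 s y = (active_arrow e f0 a0 s y - active_arrow e f0 a0 (s + 2) y) / 2"
proof (cases "even (y - int s - e)")
  case True
  then have "chips f0 a0 y (Suc s) = 0" by (intro chips_parity[OF assms]) auto
  then have "arrow f0 a0 y (s + 2) = (-1) ^ chips f0 a0 y s * arrow f0 a0 y s"
    by (simp del: chips.simps)
  then show ?thesis using True
    by (cases "even (chips f0 a0 y s)")
       (simp_all add: flow_def active_arrow_def odd_iff_mod_2_eq_one del: chips.simps arrow.simps)
next
  case False
  then have "chips f0 a0 y s = 0" by (intro chips_parity[OF assms]) auto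
  then show ?thesis using False by (simp add: flow_def active_arrow_def del: chips.simps arrow.simps)
qed

text \<open>
  Duhamel's formula for \<open>f(t+1) = P f(t) - D A(t)\<close>: the imbalance created at time \<open>s\<close> is spread by the
  random walk during the remaining \<open>t - 1 - s\<close> steps.
\<close>

lemma chips_eq_expected_minus_flow:
  assumes "arrows a0"
  shows "real (chips f0 a0 x t) = expected_chips f0 x t
           - central_diff (\<lambda>z. \<Sum>w<t. (avg ^^ w) (flow f0 a0 (t - 1 - w)) z) x"
proof -
  define G where "G t z = (\<Sum>w<t. (avg ^^ w) (flow f0 a0 (t - 1 - w)) z)" for t z
  have G_Suc: "G (Suc t) z = flow f0 a0 t z + avg (G t) z" for t z
  proof -
    have "G (Suc t) z = flow f0 a0 t z + (\<Sum>w<t. avg ((avg ^^ w) (flow f0 a0 (t - 1 - w))) z)"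
      unfolding G_def by (subst sum.lessThan_Suc_shift) simp
    also have "(\<Sum>w<t. avg ((avg ^^ w) (flow f0 a0 (t - 1 - w))) z) = avg (G t) z"
      unfolding G_def avg_def[of _ z] by (simp add: sum.distrib flip: sum_divide_distrib)
    finally show ?thesis .
  qed
  have "real (chips f0 a0 x t) = (avg ^^ t) (\<lambda>y. real (f0 y)) x - central_diff (G t) x"
  proof (induction t arbitrary: x)
    case 0
    show ?case by (simp add: G_def central_diff_def)
  next
    case (Suc t)
    have "real (chips f0 a0 x (Suc t)) = avg (\<lambda>y. real (chips f0 a0 y t)) x - central_diff (flow f0 a0 t) x"
      by (subst chips_Suc_real[OF assms]) (simp add: avg_def central_diff_def flow_def field_simps)
    also have "\<dots> = (avg ^^ Suc t) (\<lambda>y. real (f0 y)) x - (avg (central_diff (G t)) x + central_diff (flow f0 a0 t) x)"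
      by (simp add: Suc avg_def[of _ x] field_simps)
    also have "avg (central_diff (G t)) x + central_diff (flow f0 a0 t) x = central_diff (G (Suc t)) x"
      by (simp add: central_diff_def G_Suc flip: central_diff_avg) (simp add: add_divide_distrib diff_divide_distrib)
    finally show ?case .
  qed
  then show ?thesis by (simp add: G_def[abs_def] expected_chips_avg_pow)
qed

lemma sum_central_diff_interval:
  "(\<Sum>x\<in>{b..<b + int L}. central_diff g x) = (g (b + int L) + g (b + int L - 1) - g b - g (b - 1)) / 2"
proof (induction L)
  case (Suc L)
  have "{b..<b + int (Suc L)} = insert (b + int L) {b..<b + int L}" by auto
  then show ?case using Suc by (simp add: central_diff_def field_simps)
qed simp

lemma DISC_interval:
  assumes "arrows a0"
  shows "DISC f0 a0 {b..<b + int L} t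
    = - (\<Sum>x\<in>{b..<b + int L}. central_diff (\<lambda>z. \<Sum>w<t. (avg ^^ w) (flow f0 a0 (t - 1 - w)) z) x)"
  by (simp add: DISC_def chips_eq_expected_minus_flow[OF assms] sum_subtractf)

text \<open>
  Summation by parts in steps of two, using \<open>P\<^bsup>w+2\<^esup> - P\<^sup>w = D\<^sup>2 P\<^sup>w\<close>.
\<close>

lemma abel_summation_avg_pow:
  "(\<Sum>w<N+2. (avg ^^ w) (\<lambda>y. \<rho> (w + 2) y - \<rho> w y) x)
   = (avg ^^ N) (\<rho> (N + 2)) x + (avg ^^ (N + 1)) (\<rho> (N + 3)) x - \<rho> 0 x - avg (\<rho> 1) x
     - (\<Sum>w<N. central_diff (central_diff ((avg ^^ w) (\<rho> (w + 2)))) x)"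
proof (induction N)
  case 0
  show ?case by (simp add: avg_def numeral_eq_Suc field_simps)
next
  case (Suc N)
  have "(\<Sum>w<Suc N+2. (avg ^^ w) (\<lambda>y. \<rho> (w + 2) y - \<rho> w y) x)
     = (\<Sum>w<N+2. (avg ^^ w) (\<lambda>y. \<rho> (w + 2) y - \<rho> w y) x)
       + ((avg ^^ (N + 2)) (\<rho> (N + 4)) x - (avg ^^ (N + 2)) (\<rho> (N + 2)) x)"
    by (simp add: avg_pow_diff numeral_eq_Suc del: funpow.simps)
  moreover have "central_diff (central_diff ((avg ^^ N) (\<rho> (N + 2)))) x
      = (avg ^^ (N + 2)) (\<rho> (N + 2)) x - (avg ^^ N) (\<rho> (N + 2)) x"
    by (simp add: central_diff_central_diff numeral_eq_Suc)
  ultimately show ?case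
    unfolding Suc by (simp add: numeral_eq_Suc del: funpow.simps)
qed

text \<open>
  The arrows at delay \<open>w\<close> before time \<open>t + 1\<close>. At delays that would lead before time \<open>0\<close> they are continued with
  period two, so that \<open>flow_sum_eq\<close> holds with any number \<open>N \<ge> t\<close> of terms and small \<open>t\<close> needs no separate
  treatment.
\<close>

definition reversed_arrow :: "int \<Rightarrow> (int \<Rightarrow> nat) \<Rightarrow> (int \<Rightarrow> int) \<Rightarrow> nat \<Rightarrow> nat \<Rightarrow> int \<Rightarrow> real" where
  "reversed_arrow e f0 a0 t w =
     active_arrow e f0 a0 (if w \<le> t + 1 then t + 1 - w else (w + t + 1) mod 2)"

lemma flow_sum_eq:
  assumes "parity_config e f0" and "t \<le> N"
  shows "2 * (\<Sum>w<t. (avg ^^ w) (flow f0 a0 (t - 1 - w)) x)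
    = (\<Sum>w<N. (avg ^^ w) (\<lambda>y. reversed_arrow e f0 a0 t (w + 2) y - reversed_arrow e f0 a0 t w y) x)"
proof -
  define \<rho> where "\<rho> = reversed_arrow e f0 a0 t"
  have low: "(\<lambda>y. \<rho> (w + 2) y - \<rho> w y) = (\<lambda>y. 2 * flow f0 a0 (t - 1 - w) y)" if "w < t" for w
  proof -
    have "t + 1 - w = (t - 1 - w) + 2" "t + 1 - (w + 2) = t - 1 - w" using that by auto
    then show ?thesis
      using that by (auto simp: \<rho>_def reversed_arrow_def flow_eq_arrow_diff[OF assms(1)])
  qed
  have high: "\<rho> (w + 2) = \<rho> w" if "w \<ge> t" for w
  proof -
    have "(w + 2 + t + 1) mod 2 = (if w \<le> t + 1 then t + 1 - w else (w + t + 1) mod 2)"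
      using that by (auto; presburger)
    then show ?thesis using that unfolding \<rho>_def reversed_arrow_def by simp
  qed
  have "(\<Sum>w<N. (avg ^^ w) (\<lambda>y. \<rho> (w + 2) y - \<rho> w y) x) = (\<Sum>w<t. (avg ^^ w) (\<lambda>y. \<rho> (w + 2) y - \<rho> w y) x)"
    using assms(2) by (intro sum.mono_neutral_right) (auto simp: high avg_pow_const simp del: add_2_eq_Suc')
  also have "\<dots> = (\<Sum>w<t. 2 * (avg ^^ w) (flow f0 a0 (t - 1 - w)) x)"
    by (intro sum.cong refl) (simp add: low avg_pow_cmult del: add_2_eq_Suc' diff_diff_left)
  finally show ?thesis by (simp add: \<rho>_def sum_distrib_left)
qed

lemma reversed_arrow_bound:
  assumes "arrows a0"
  shows "\<bar>reversed_arrow e f0 a0 t w y\<bar> \<le> 1"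
proof -
  have "\<bar>real_of_int (arrow f0 a0 y s)\<bar> \<le> 1" for s
    using arrow_values[OF assms, of f0 y s] by auto
  then show ?thesis by (simp add: reversed_arrow_def active_arrow_def)
qed

section \<open>The upper bound\<close>

text \<open>
  The delays are cut at \<open>L\<^sup>2\<close>, the time in which a walk covers a distance of order \<open>L\<close>. Smaller delays are kept
  through their values \<open>g\<close> at the end points of the interval. Larger ones are summed over the interval, where the
  extra difference makes the series converge to a bounded value.
\<close>

lemma DISC_bound_by_near_terms:
  fixes t :: nat
  assumes a0: "arrows a0" and f0: "parity_config e f0" and L: "L \<ge> 1"
  defines "g \<equiv> \<lambda>z. \<Sum>w<L\<^sup>2. central_diff (central_diff ((avg ^^ w) (reversed_arrow e f0 a0 t (w + 2)))) z"
  shows "\<bar>DISC f0 a0 {b..<b + int L} t\<bar>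
    \<le> 10 + (\<bar>g (b + int L)\<bar> + \<bar>g (b + int L - 1)\<bar> + \<bar>g b\<bar> + \<bar>g (b - 1)\<bar>) / 4"
proof -
  define \<rho> where "\<rho> = reversed_arrow e f0 a0 t"
  have \<rho>: "\<bar>\<rho> w y\<bar> \<le> 1" for w y
    using reversed_arrow_bound[OF a0] by (simp add: \<rho>_def)
  define N where "N = L\<^sup>2 + t"
  define B where "B z = (avg ^^ N) (\<rho> (N + 2)) z + (avg ^^ (N + 1)) (\<rho> (N + 3)) z - \<rho> 0 z - avg (\<rho> 1) z" for z
  define d where "d w z = central_diff (central_diff ((avg ^^ w) (\<rho> (w + 2)))) z" for w z
  define far where "far z = (\<Sum>w\<in>{L\<^sup>2..<L\<^sup>2 + t}. d w z)" for z
  define G where "G z = (\<Sum>w<t. (avg ^^ w) (flow f0 a0 (t - 1 - w)) z)" for z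
  define X where "X = {b..<b + int L}"
  have B: "\<bar>B z\<bar> \<le> 4" for z
  proof -
    have "\<bar>(avg ^^ N) (\<rho> (N + 2)) z\<bar> \<le> 1" "\<bar>(avg ^^ (N + 1)) (\<rho> (N + 3)) z\<bar> \<le> 1"
         "\<bar>\<rho> 0 z\<bar> \<le> 1" "\<bar>(avg ^^ 1) (\<rho> 1) z\<bar> \<le> 1"
      by (rule avg_pow_bound \<rho>)+
    then show ?thesis unfolding B_def by simp
  qed
  have split: "2 * G z = B z - g z - far z" for z
  proof -
    have "2 * G z = (\<Sum>w<N+2. (avg ^^ w) (\<lambda>y. \<rho> (w + 2) y - \<rho> w y) z)"
      unfolding G_def \<rho>_def by (rule flow_sum_eq[OF f0]) (simp add: N_def)
    also have "\<dots> = B z - (\<Sum>w<N. d w z)"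
      unfolding abel_summation_avg_pow B_def d_def ..
    also have "(\<Sum>w<N. d w z) = (\<Sum>w<L\<^sup>2. d w z) + far z"
      unfolding far_def N_def lessThan_atLeast0 by (rule sum.atLeastLessThan_concat[symmetric]) auto
    also have "(\<Sum>w<L\<^sup>2. d w z) = g z"
      by (simp add: g_def d_def \<rho>_def)
    finally show ?thesis by simp
  qed
  have far: "\<bar>central_diff far x\<bar> \<le> 12 / real L" for x
  proof -
    have "central_diff far x = (\<Sum>w\<in>{L\<^sup>2..<L\<^sup>2 + t}. (central_diff ^^ 3) ((avg ^^ w) (\<rho> (w + 2))) x)"
      unfolding far_def[abs_def] central_diff_sum by (simp add: d_def[abs_def] eval_nat_numeral)
    also have "\<bar>\<dots>\<bar> \<le> (\<Sum>w\<in>{L\<^sup>2..<L\<^sup>2 + t}. 6 / ((real w + 1) * sqrt (real w + 1)))"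
      by (rule order.trans[OF sum_abs]) (intro sum_mono central_diff3_bound \<rho>)
    also have "\<dots> = 6 * (\<Sum>w\<in>{L\<^sup>2..<L\<^sup>2 + t}. 1 / ((real w + 1) * sqrt (real w + 1)))"
      by (simp add: sum_distrib_left)
    also have "\<dots> \<le> 6 * (2 / sqrt (real (L\<^sup>2)))"
      using L by (intro mult_left_mono sum_inverse_three_halves_le) auto
    finally show ?thesis by simp
  qed
  define P where "P = \<bar>g (b + int L)\<bar> + \<bar>g (b + int L - 1)\<bar> + \<bar>g b\<bar> + \<bar>g (b - 1)\<bar>"
  have four: "\<bar>(p + q - u - v) / 2\<bar> \<le> (\<bar>p\<bar> + \<bar>q\<bar> + \<bar>u\<bar> + \<bar>v\<bar>) / 2" for p q u v :: real
  proof -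
    have "p + q - u - v = p + q + (- u) + (- v)" by simp
    then have "\<bar>p + q - u - v\<bar> \<le> \<bar>p\<bar> + \<bar>q\<bar> + \<bar>- u\<bar> + \<bar>- v\<bar>"
      by (simp only:)
    then show ?thesis by simp
  qed
  have "(\<Sum>x\<in>X. central_diff far x) \<le> 12" "- 12 \<le> (\<Sum>x\<in>X. central_diff far x)"
  proof -
    have "\<bar>\<Sum>x\<in>X. central_diff far x\<bar> \<le> (\<Sum>x\<in>X. 12 / real L)"
      by (rule order.trans[OF sum_abs]) (intro sum_mono far)
    also have "\<dots> = 12" using L by (simp add: X_def)
    finally show "(\<Sum>x\<in>X. central_diff far x) \<le> 12" "- 12 \<le> (\<Sum>x\<in>X. central_diff far x)" by auto
  qed
  moreover have "2 * DISC f0 a0 X t = (\<Sum>x\<in>X. central_diff g x) + (\<Sum>x\<in>X. central_diff far x) - (\<Sum>x\<in>X. central_diff B x)"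
  proof -
    have "2 * DISC f0 a0 X t = - (\<Sum>x\<in>X. 2 * central_diff G x)"
      unfolding X_def DISC_interval[OF a0] G_def[abs_def] by (simp add: sum_distrib_left)
    also have "\<dots> = - (\<Sum>x\<in>X. central_diff B x - central_diff g x - central_diff far x)"
    proof -
      have "2 * central_diff G x = central_diff B x - central_diff g x - central_diff far x" for x
        using split[of "x + 1"] split[of "x - 1"] by (simp add: central_diff_def field_simps)
      then show ?thesis by simp
    qed
    finally show ?thesis by (simp add: sum_subtractf)
  qed
  moreover have "\<bar>\<Sum>x\<in>X. central_diff B x\<bar> \<le> 8"
    unfolding X_def sum_central_diff_interval
    by (rule order.trans[OF four])
       (use add_mono[OF add_mono[OF add_mono[OF B[of "b + int L"] B[of "b + int L - 1"]] B[of b]] B[of "b - 1"]] in simp)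
  moreover have "\<bar>\<Sum>x\<in>X. central_diff g x\<bar> \<le> P / 2"
    unfolding X_def sum_central_diff_interval P_def by (rule four)
  ultimately show ?thesis unfolding X_def[symmetric] P_def[symmetric] by linarith
qed

lemma square_le_of_near_terms:
  fixes D :: real
  assumes "\<bar>D\<bar> \<le> 10 + (\<bar>p\<bar> + \<bar>q\<bar> + \<bar>r\<bar> + \<bar>s\<bar>) / 4"
  shows "D\<^sup>2 \<le> 200 + (p\<^sup>2 + q\<^sup>2 + r\<^sup>2 + s\<^sup>2) / 2"
proof -
  define S where "S = \<bar>p\<bar> + \<bar>q\<bar> + \<bar>r\<bar> + \<bar>s\<bar>"
  have four: "(a + b + c + d)\<^sup>2 \<le> 4 * (a\<^sup>2 + b\<^sup>2 + c\<^sup>2 + d\<^sup>2)" for a b c d :: real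
  proof -
    have "0 \<le> (a - b)\<^sup>2 + (a - c)\<^sup>2 + (a - d)\<^sup>2 + (b - c)\<^sup>2 + (b - d)\<^sup>2 + (c - d)\<^sup>2" by simp
    then show ?thesis by (simp add: power2_eq_square algebra_simps)
  qed
  have "D\<^sup>2 \<le> (10 + S / 4)\<^sup>2"
    using assms power_mono[of "\<bar>D\<bar>" "10 + S / 4" 2] by (simp add: S_def)
  also have "\<dots> \<le> 200 + S\<^sup>2 / 8"
  proof -
    have "0 \<le> (10 - S / 4)\<^sup>2" by simp
    then show ?thesis by (simp add: power2_eq_square algebra_simps)
  qed
  also have "S\<^sup>2 \<le> 4 * (p\<^sup>2 + q\<^sup>2 + r\<^sup>2 + s\<^sup>2)"
    using four[of "\<bar>p\<bar>" "\<bar>q\<bar>" "\<bar>r\<bar>" "\<bar>s\<bar>"] by (simp add: S_def)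
  finally show ?thesis by (simp add: field_simps)
qed

lemma translate_interval: "translate {b..<b + int L} k = {b + k..<b + k + int L}"
  unfolding translate_def by (simp add: image_add_atLeastLessThan' add_ac)

theorem discrepancy_second_moment_upper_bound:
  assumes L: "L \<ge> 2" and M: "M \<ge> L\<^sup>2" and a0: "arrows a0" and f0: "parity_config e f0"
    and X: "interval_of_length L X"
  shows "1 / real M * (\<Sum>k = 1..M. (DISC f0 a0 (translate X (int k)) t)\<^sup>2) \<le> 1680 * ln (real L)"
proof -
  obtain b where b: "X = {b..<b + int L}" using X by (auto simp: interval_of_length_def)
  define g where "g z = (\<Sum>w<L\<^sup>2. central_diff (central_diff ((avg ^^ w) (reversed_arrow e f0 a0 t (w + 2)))) z)" for z
  define S where "S = 32 * (real M + 2 * real (L\<^sup>2) + 2) * (1 + ln (real (L\<^sup>2)))"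
  define Q where "Q c = (\<Sum>k=1..M. (g (c + int k))\<^sup>2)" for c
  have near: "Q c \<le> S" for c
    unfolding Q_def g_def S_def
    by (rule near_part_second_moment[where \<rho> = "\<lambda>w. reversed_arrow e f0 a0 t (w + 2)"])
       (use reversed_arrow_bound[OF a0] L in auto)
  have pt: "(DISC f0 a0 (translate X (int k)) t)\<^sup>2
      \<le> 200 + ((g (b + int L + int k))\<^sup>2 + (g (b + int L - 1 + int k))\<^sup>2
                + (g (b + int k))\<^sup>2 + (g (b - 1 + int k))\<^sup>2) / 2" for k
    unfolding b translate_interval
    by (rule square_le_of_near_terms)
       (use DISC_bound_by_near_terms[OF a0 f0, of L "b + int k" t] L in \<open>simp add: g_def algebra_simps\<close>)
  have "(\<Sum>k = 1..M. (DISC f0 a0 (translate X (int k)) t)\<^sup>2)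
     \<le> 200 * real M + (Q (b + int L) + Q (b + int L - 1) + Q b + Q (b - 1)) / 2"
    by (rule order.trans[OF sum_mono[OF pt]]) (simp add: Q_def sum.distrib flip: sum_divide_distrib)
  also have "\<dots> \<le> 200 * real M + 2 * S"
    using add_mono[OF add_mono[OF add_mono[OF near[of "b + int L"] near[of "b + int L - 1"]] near[of b]] near[of "b - 1"]]
    by simp
  also have "\<dots> \<le> 200 * real M + 2 * (32 * (5 * real M) * (1 + 2 * ln (real L)))"
  proof -
    have "real M \<ge> real (L\<^sup>2)" using M by (simp only: of_nat_le_iff)
    moreover have "real (L\<^sup>2) \<ge> 1" using L by simp
    ultimately have "real M + 2 * real (L\<^sup>2) + 2 \<le> 5 * real M" by linarith
    moreover have "1 + ln (real (L\<^sup>2)) = 1 + 2 * ln (real L)" using L by (simp add: ln_realpow)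
    moreover have "0 \<le> ln (real L)" using L by simp
    ultimately have "S \<le> 32 * (5 * real M) * (1 + 2 * ln (real L))"
      unfolding S_def by (simp only:) (intro mult_right_mono mult_left_mono; simp)
    then show ?thesis by linarith
  qed
  also have "\<dots> = real M * (520 + 640 * ln (real L))" by (simp add: algebra_simps)
  also have "\<dots> \<le> real M * (1680 * ln (real L))"
  proof -
    have "1 / 2 \<le> ln (2::real)" using ln2_ge_two_thirds by simp
    also have "\<dots> \<le> ln (real L)" using L by simp
    finally show ?thesis by (intro mult_left_mono) auto
  qed
  finally have "(\<Sum>k = 1..M. (DISC f0 a0 (translate X (int k)) t)\<^sup>2) \<le> real M * (1680 * ln (real L))" .
  moreover have "M > 0" using M L by (metis gr0I le_zero_eq not_numeral_le_zero power_eq_0_iff)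
  ultimately show ?thesis by (simp add: field_simps)
qed

section \<open>Prescribing the arrows\<close>

definition neighbour_sum :: "(int \<Rightarrow> nat) \<Rightarrow> int \<Rightarrow> nat" where
  "neighbour_sum g x = g (x - 1) + g (x + 1)"

text \<open>
  The equation \<open>q (y-1) + q (y+1) = p y\<close> modulo 2 is solved from left to right, starting with \<open>q = 0\<close> at the left
  end; this is why parities are prescribed on a half line.
\<close>

lemma neighbour_sum_solvable_mod_2:
  "\<exists>q. \<forall>y\<ge>b. even (neighbour_sum q y + p y)"
proof -
  define q where "q x = (\<Sum>z\<in>{z \<in> {b..x - 1}. even (z - x + 1)}. p z)" for x
  have "even (neighbour_sum q y + p y)" if "y \<ge> b" for y
  proof -
    have "{z \<in> {b..y + 1 - 1}. even (z - (y + 1) + 1)} = insert y {z \<in> {b..y - 1 - 1}. even (z - (y - 1) + 1)}"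
      using that by (auto; presburger)
    moreover have "y \<notin> {z \<in> {b..y - 1 - 1}. even (z - (y - 1) + 1)}" by auto
    ultimately have "q (y + 1) = p y + q (y - 1)"
      unfolding q_def by (simp only: sum.insert finite_Collect_conjI finite_atLeastAtMost_int Collect_mem_eq simp_thms)
    then have "neighbour_sum q y + p y = 2 * (q (y - 1) + p y)" by (simp add: neighbour_sum_def)
    then show ?thesis by simp
  qed
  then show ?thesis by blast
qed

lemma neighbour_sum_pow_solvable_mod_2:
  "\<exists>\<epsilon>. (\<forall>y. odd y \<longrightarrow> \<epsilon> y = 0) \<and>
       (\<forall>y\<ge>b. even (y - int T) \<longrightarrow> even ((neighbour_sum ^^ T) \<epsilon> y + p y))"
proof (induction T arbitrary: b p)
  case 0
  show ?case by (rule exI[of _ "\<lambda>y. if even y then p y else 0"]) auto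
next
  case (Suc T)
  obtain q where q: "\<And>y. y \<ge> b \<Longrightarrow> even (neighbour_sum q y + p y)"
    using neighbour_sum_solvable_mod_2 by blast
  obtain \<epsilon> where \<epsilon>: "\<forall>y. odd y \<longrightarrow> \<epsilon> y = 0"
    and e: "\<And>y. y \<ge> b - 1 \<Longrightarrow> even (y - int T) \<Longrightarrow> even ((neighbour_sum ^^ T) \<epsilon> y + q y)"
    using Suc[of "b - 1" q] by blast
  have "even ((neighbour_sum ^^ Suc T) \<epsilon> y + p y)" if "y \<ge> b" "even (y - int (Suc T))" for y
    using q[of y] e[of "y - 1"] e[of "y + 1"] that by (auto simp: neighbour_sum_def)
  then show ?case using \<epsilon> by blast
qed

text \<open>
  A pile of \<open>2\<^sup>T\<close> chips splits evenly for \<open>T\<close> steps, so it moves no arrow and evolves independently of the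
  other chips, by Pascal's rule.
\<close>

lemma chips_add_power_of_two:
  assumes a0: "arrows a0" and "s \<le> T"
  shows "(\<forall>x. chips (\<lambda>y. f0 y + 2 ^ T * \<epsilon> y) a0 x s = chips f0 a0 x s + 2 ^ (T - s) * (neighbour_sum ^^ s) \<epsilon> x)
       \<and> (\<forall>x. arrow (\<lambda>y. f0 y + 2 ^ T * \<epsilon> y) a0 x s = arrow f0 a0 x s)"
  using assms(2)
proof (induction s)
  case (Suc s)
  define f1 where "f1 = (\<lambda>y. f0 y + 2 ^ T * \<epsilon> y)"
  define m :: nat where "m = 2 ^ (T - Suc s)"
  have p: "(2::nat) ^ (T - s) = 2 * m"
    using Suc.prems by (simp add: m_def Suc_diff_Suc flip: power_Suc)
  have c: "chips f1 a0 x s = chips f0 a0 x s + 2 * m * (neighbour_sum ^^ s) \<epsilon> x"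
   and a: "arrow f1 a0 x s = arrow f0 a0 x s" for x
    using Suc p by (auto simp: f1_def)
  have c2: "chips f1 a0 x s mod 2 = chips f0 a0 x s mod 2" for x
    unfolding c by (simp add: mult.assoc)
  have "chips f1 a0 x (Suc s) = chips f0 a0 x (Suc s) + m * (neighbour_sum ^^ Suc s) \<epsilon> x" for x
  proof -
    have "real (chips f1 a0 x (Suc s)) = real (chips f0 a0 x (Suc s) + m * (neighbour_sum ^^ Suc s) \<epsilon> x)"
      unfolding of_nat_add chips_Suc_real[OF a0] a c2
      by (simp add: c neighbour_sum_def algebra_simps del: chips.simps)
    then show ?thesis by (simp only: of_nat_eq_iff)
  qed
  moreover have "arrow f1 a0 x (Suc s) = arrow f0 a0 x (Suc s)" for x
    by (simp add: a c mult.assoc power_add del: chips.simps)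
  ultimately show ?case unfolding f1_def m_def by blast
qed simp

text \<open>
  Induction on \<open>T\<close>: the piles of \<open>2\<^sup>T\<close> chips that correct the parities at time \<open>T\<close> leave the earlier ones unchanged.
\<close>

lemma parity_forcing:
  assumes a0: "arrows a0"
  shows "\<exists>f0. even_config f0 \<and> (\<forall>s<T. \<forall>y\<ge>b. even (y - int s) \<longrightarrow> even (chips f0 a0 y s + p s y))"
proof (induction T)
  case 0
  show ?case by (rule exI[of _ "\<lambda>_. 0"]) (simp add: even_config_def)
next
  case (Suc T)
  then obtain f0 where f0: "even_config f0"
    "\<And>s y. s < T \<Longrightarrow> y \<ge> b \<Longrightarrow> even (y - int s) \<Longrightarrow> even (chips f0 a0 y s + p s y)" by blast
  obtain \<epsilon> where \<epsilon>: "\<forall>y. odd y \<longrightarrow> \<epsilon> y = 0"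
    "\<And>y. y \<ge> b \<Longrightarrow> even (y - int T) \<Longrightarrow> even ((neighbour_sum ^^ T) \<epsilon> y + (chips f0 a0 y T + p T y))"
    using neighbour_sum_pow_solvable_mod_2[of b T "\<lambda>y. chips f0 a0 y T + p T y"] by blast
  define f1 where "f1 = (\<lambda>y. f0 y + 2 ^ T * \<epsilon> y)"
  have c: "chips f1 a0 x s = chips f0 a0 x s + 2 ^ (T - s) * (neighbour_sum ^^ s) \<epsilon> x" if "s \<le> T" for s x
    using chips_add_power_of_two[OF a0 that, of f0 \<epsilon>] by (simp add: f1_def)
  have "even (chips f1 a0 y s + p s y)" if "s < Suc T" "y \<ge> b" "even (y - int s)" for s y
  proof (cases "s = T")
    case True
    then show ?thesis using \<epsilon>(2)[of y] that by (simp add: c) presburger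
  next
    case False
    then show ?thesis using f0(2)[of s y] that by (simp add: c)
  qed
  moreover have "even_config f1" using f0(1) \<epsilon>(1) by (simp add: even_config_def f1_def)
  ultimately show ?case by blast
qed

text \<open>
  A vertex is empty at the times of the other parity, so its arrow at time \<open>s + 2\<close> is the one at time \<open>s\<close>,
  reversed if and only if the number of chips at time \<open>s\<close> is odd. The initial arrows on even and odd positions serve as the
  prescribed ones at times \<open>0\<close> and \<open>1\<close>.
\<close>

lemma arrow_forcing:
  fixes \<rho> :: "nat \<Rightarrow> int \<Rightarrow> int"
  assumes \<rho>: "\<And>s y. \<rho> s y \<in> {-1, 1}"
  shows "\<exists>f0 a0. arrows a0 \<and> even_config f0 \<and>
           (\<forall>s\<le>T. \<forall>y\<ge>b. even (y - int s) \<longrightarrow> arrow f0 a0 y s = \<rho> s y)"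
proof -
  define a0 where "a0 y = (if even y then \<rho> 0 y else \<rho> 1 y)" for y
  have a0: "arrows a0" using \<rho> by (simp add: arrows_def a0_def)
  define p :: "nat \<Rightarrow> int \<Rightarrow> nat" where "p s y = (if \<rho> (s + 2) y = \<rho> s y then 0 else 1)" for s y
  obtain f0 where f0: "even_config f0"
    "\<And>s y. s < T \<Longrightarrow> y \<ge> b \<Longrightarrow> even (y - int s) \<Longrightarrow> even (chips f0 a0 y s + p s y)"
    using parity_forcing[OF a0, of T b p] by blast
  have f0': "parity_config 0 f0" using f0(1) by (simp add: even_config_def parity_config_def)
  have "arrow f0 a0 y s = \<rho> s y" if "s \<le> T" "y \<ge> b" "even (y - int s)" for s y
    using that(1,3)
  proof (induction s rule: induct_nat_012)
    case 0
    then show ?case by (simp add: a0_def)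
  next
    case 1
    then have "f0 y = 0" using f0(1) by (auto simp: even_config_def)
    then show ?case using 1 by (simp add: a0_def)
  next
    case (ge2 s)
    have e: "even (y - int s)" using ge2.prems by auto
    have "chips f0 a0 y (Suc s) = 0" by (rule chips_parity[OF f0']) (use e in auto)
    then have "arrow f0 a0 y (Suc (Suc s)) = (-1) ^ chips f0 a0 y s * arrow f0 a0 y s"
      by (simp del: chips.simps)
    also have "\<dots> = (-1) ^ chips f0 a0 y s * \<rho> s y" using ge2 e by simp
    also have "\<dots> = \<rho> (Suc (Suc s)) y"
      using f0(2)[of s y] ge2.prems that(2) e \<rho>[of s y] \<rho>[of "Suc (Suc s)" y]
      by (cases "even (chips f0 a0 y s)") (auto simp: p_def split: if_splits)
    finally show ?case .
  qed
  then show ?thesis using a0 f0(1) by blast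
qed


section \<open>The lower bound\<close>

text \<open>
  A function that is convex in each coordinate is maximal over a cube at a vertex; the coordinates are rounded one
  after the other.
\<close>

lemma round_to_signs:
  fixes \<Phi> :: "('i \<Rightarrow> real) \<Rightarrow> real"
  assumes "finite I"
    and step: "\<And>r i. \<bar>r i\<bar> \<le> 1 \<Longrightarrow> \<Phi> r \<le> max (\<Phi> (r(i := 1))) (\<Phi> (r(i := -1)))"
    and r: "\<And>i. \<bar>r i\<bar> \<le> 1"
  shows "\<exists>r'. (\<forall>i\<in>I. r' i \<in> {-1, 1}) \<and> (\<forall>i. i \<notin> I \<longrightarrow> r' i = r i) \<and> \<Phi> r \<le> \<Phi> r'"
  using assms(1)
proof (induction I rule: finite_induct)
  case (insert i I)
  then obtain r' where r': "\<forall>i\<in>I. r' i \<in> {-1, 1}" "\<forall>i. i \<notin> I \<longrightarrow> r' i = r i" "\<Phi> r \<le> \<Phi> r'"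
    by blast
  have "\<bar>r' i\<bar> \<le> 1" using r' r insert.hyps by simp
  from step[of r' i, OF this] obtain s where s: "s \<in> {-1, 1}" "\<Phi> r' \<le> \<Phi> (r'(i := s))"
    by (auto simp: le_max_iff_disj)
  have "\<Phi> r \<le> \<Phi> (r'(i := s))" using r'(3) s(2) by (rule order.trans)
  moreover have "\<forall>j\<in>insert i I. (r'(i := s)) j \<in> {-1, 1}" "\<forall>j. j \<notin> insert i I \<longrightarrow> (r'(i := s)) j = r j"
    using r' s(1) by auto
  ultimately show ?case by blast
qed auto

text \<open>
  The value of \<open>(\<Sum>w<t. P\<^sup>w A(t-1-w))\<close> when \<open>r (w, y)\<close> is the arrow at \<open>y\<close> at time \<open>t + 1 - w\<close>, extended to
  arbitrary real patterns \<open>r\<close>.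
\<close>

definition response :: "nat \<Rightarrow> (nat \<times> int \<Rightarrow> real) \<Rightarrow> int \<Rightarrow> real" where
  "response t r x = (\<Sum>w<t. (avg ^^ w) (\<lambda>y. r (w + 2, y) - r (w, y)) x) / 2"

lemma response_linear:
  "response t (\<lambda>i. c * u i + d * v i) x = c * response t u x + d * response t v x"
proof -
  have "(avg ^^ w) (\<lambda>y. (c * u (w + 2, y) + d * v (w + 2, y)) - (c * u (w, y) + d * v (w, y))) x
      = c * (avg ^^ w) (\<lambda>y. u (w + 2, y) - u (w, y)) x + d * (avg ^^ w) (\<lambda>y. v (w + 2, y) - v (w, y)) x" for w
    unfolding avg_pow_diff avg_pow_add avg_pow_cmult by (simp add: algebra_simps)
  then show ?thesis
    by (simp add: response_def sum.distrib add_divide_distrib flip: sum_distrib_left)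
qed

lemma response_cong:
  assumes "\<And>w y. w \<le> t + 1 \<Longrightarrow> \<bar>y - x\<bar> \<le> int t \<Longrightarrow> even (y - x - int w) \<Longrightarrow> u (w, y) = v (w, y)"
  shows "response t u x = response t v x"
proof -
  have "(avg ^^ w) (\<lambda>y. u (w + 2, y) - u (w, y)) x = (avg ^^ w) (\<lambda>y. v (w + 2, y) - v (w, y)) x"
    if "w < t" for w
    by (rule avg_pow_cong, rule arg_cong2[of _ _ _ _ "(-)"]; rule assms) (use that in auto)
  then show ?thesis by (simp add: response_def)
qed

text \<open>
  The discrepancy of an interval that starts at \<open>b\<close>, for the arrow pattern \<open>r\<close>, with \<open>n\<close> the largest even number
  not exceeding the length of the interval; see \<open>DISC_eq_pattern_disc\<close>.
\<close>

definition pattern_disc :: "nat \<Rightarrow> nat \<Rightarrow> (nat \<times> int \<Rightarrow> real) \<Rightarrow> int \<Rightarrow> real" where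
  "pattern_disc t n r b = (response t r b - response t r (b + int n)) / 2"

lemma pattern_disc_linear:
  "pattern_disc t n (\<lambda>i. c * u i + d * v i) b
     = c * pattern_disc t n u b + d * pattern_disc t n v b"
  by (simp add: pattern_disc_def response_linear algebra_simps add_divide_distrib diff_divide_distrib)

lemma square_convex_combination_le:
  fixes p q c :: real
  assumes "0 \<le> c" "c \<le> 1"
  shows "(c * p + (1 - c) * q)\<^sup>2 \<le> c * p\<^sup>2 + (1 - c) * q\<^sup>2"
proof -
  have "0 \<le> c * (1 - c) * (p - q)\<^sup>2" using assms by simp
  then show ?thesis by (simp add: power2_eq_square algebra_simps)
qed

lemma pattern_disc_round:
  fixes r :: "nat \<times> int \<Rightarrow> real" and K :: "int set" and t n :: nat
  assumes "\<bar>r i\<bar> \<le> 1"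
  defines "\<Phi> \<equiv> \<lambda>r. \<Sum>b\<in>K. (pattern_disc t n r b)\<^sup>2"
  shows "\<Phi> r \<le> max (\<Phi> (r(i := 1))) (\<Phi> (r(i := -1)))"
proof -
  define c where "c = (1 + r i) / 2"
  have c: "0 \<le> c" "c \<le> 1" using assms(1) by (auto simp: c_def abs_le_iff)
  have r: "r = (\<lambda>j. c * (r(i := 1)) j + (1 - c) * (r(i := -1)) j)"
    by (auto simp: c_def field_simps)
  have "\<Phi> r \<le> (\<Sum>b\<in>K. c * (pattern_disc t n (r(i := 1)) b)\<^sup>2 + (1 - c) * (pattern_disc t n (r(i := -1)) b)\<^sup>2)"
    unfolding \<Phi>_def
    by (subst r, unfold pattern_disc_linear) (intro sum_mono square_convex_combination_le c)
  also have "\<dots> = c * \<Phi> (r(i := 1)) + (1 - c) * \<Phi> (r(i := -1))"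
    by (simp add: \<Phi>_def sum.distrib sum_distrib_left)
  also have "\<dots> \<le> c * max (\<Phi> (r(i := 1))) (\<Phi> (r(i := -1))) + (1 - c) * max (\<Phi> (r(i := 1))) (\<Phi> (r(i := -1)))"
    using c by (intro add_mono mult_left_mono) auto
  finally show ?thesis by (simp add: algebra_simps)
qed

lemma jordan_sin_lower:
  assumes "0 \<le> x" "x \<le> pi / 2"
  shows "2 * x / pi \<le> sin x"
proof -
  have "convex_on {0..pi / 2} (\<lambda>x. - sin x)"
    by (rule f''_ge0_imp_convex[where f' = "\<lambda>x. - cos x" and f'' = sin])
       (auto intro!: derivative_eq_intros sin_ge_zero)
  from convex_onD[OF this, of "2 * x / pi" 0 "pi / 2"] assms
  show ?thesis by (simp add: field_simps)
qed

lemma cos_pi_times_bounds: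
  assumes "0 \<le> \<tau>" "\<tau> \<le> 1"
  shows "1 - pi\<^sup>2 * \<tau>\<^sup>2 / 2 \<le> cos (pi * \<tau>)" "cos (pi * \<tau>) \<le> 1 - 2 * \<tau>\<^sup>2"
proof -
  define s where "s = sin (pi * \<tau> / 2)"
  have c: "cos (pi * \<tau>) = 1 - 2 * s\<^sup>2"
    using cos_double_sin[of "pi * \<tau> / 2"] by (simp add: s_def)
  have "pi * \<tau> / 2 \<le> pi / 2" using assms(2) by simp
  then have "\<tau> \<le> s" using jordan_sin_lower[of "pi * \<tau> / 2"] assms(1) by (simp add: s_def)
  then have "\<tau>\<^sup>2 \<le> s\<^sup>2" using assms(1) by (intro power_mono)
  then show "cos (pi * \<tau>) \<le> 1 - 2 * \<tau>\<^sup>2" using c by simp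
  have "s \<le> pi * \<tau> / 2" unfolding s_def using assms(1) by (intro sin_x_le_x) auto
  then have "s\<^sup>2 \<le> (pi * \<tau> / 2)\<^sup>2" using \<open>\<tau> \<le> s\<close> assms(1) by (intro power_mono) auto
  then show "1 - pi\<^sup>2 * \<tau>\<^sup>2 / 2 \<le> cos (pi * \<tau>)" using c by (simp add: power_mult_distrib power_divide)
qed

text \<open>
  With \<open>\<tau> = 3\<^sup>j / n\<close>, the smaller exponent is at most \<open>1/(9 \<tau>\<^sup>2)\<close>, so that power of \<open>\<mu> = cos (\<pi> \<tau>)\<close> is still close to
  \<open>1\<close>. The larger exponent is about \<open>1/\<tau>\<^sup>2\<close>, so that power is already small.
\<close>

lemma amplitude_lower_bound:
  assumes n: "2 * 3 ^ j \<le> n"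
  defines "\<mu> \<equiv> cos (pi * 3 ^ j / real n)"
  shows "1 / 10 \<le> (1 + \<mu>) * (\<mu> ^ (n\<^sup>2 div 9 ^ Suc j) - \<mu> ^ (n\<^sup>2 div 9 ^ j)) / 2"
proof -
  define \<tau> where "\<tau> = 3 ^ j / real n"
  have n0: "real n > 0" using n by (cases n) auto
  have \<tau>0: "0 < \<tau>" using n0 by (simp add: \<tau>_def)
  have "real (2 * 3 ^ j) \<le> real n" using n by (simp only: of_nat_le_iff)
  then have \<tau>: "\<tau> \<le> 1 / 2" using n0 by (simp add: \<tau>_def field_simps)
  have \<mu>_eq: "\<mu> = cos (pi * \<tau>)" by (simp add: \<mu>_def \<tau>_def)
  have "pi * \<tau> \<le> pi / 2" using \<tau> by simp
  then have \<mu>0: "0 \<le> \<mu>" unfolding \<mu>_eq using \<tau>0 by (intro cos_ge_zero) (auto intro: order.trans[of _ 0])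
  have lo: "1 - pi\<^sup>2 * \<tau>\<^sup>2 / 2 \<le> \<mu>" and hi: "\<mu> \<le> 1 - 2 * \<tau>\<^sup>2"
    using cos_pi_times_bounds[of \<tau>] \<tau>0 \<tau> by (auto simp: \<mu>_eq)
  have nine: "(9::real) ^ j = (3 ^ j)\<^sup>2" by (simp add: power2_eq_square flip: power_mult_distrib)
  have n2: "real (n\<^sup>2) = 9 ^ j / \<tau>\<^sup>2" using n0 by (simp add: \<tau>_def nine power_divide)
  define a where "a = n\<^sup>2 div 9 ^ Suc j"
  define b where "b = n\<^sup>2 div 9 ^ j"
  have "real a \<le> real (n\<^sup>2) / real (9 ^ Suc j)" unfolding a_def using of_nat_div_le_of_nat[of "n\<^sup>2" "9 ^ Suc j"] by simp
  also have "\<dots> = 1 / (9 * \<tau>\<^sup>2)" unfolding n2 by simp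
  finally have a: "real a * \<tau>\<^sup>2 \<le> 1 / 9" using \<tau>0 by (simp add: field_simps)
  have "real (n\<^sup>2) / real (9 ^ j) - 1 \<le> real b" unfolding b_def
  proof -
    have "n\<^sup>2 < 9 ^ j + n\<^sup>2 div 9 ^ j * 9 ^ j" by (rule dividend_less_div_times) simp
    then have "real (n\<^sup>2) \<le> real (9 ^ j + n\<^sup>2 div 9 ^ j * 9 ^ j)"
      by (simp only: of_nat_le_iff)
    then show "real (n\<^sup>2) / real (9 ^ j) - 1 \<le> real (n\<^sup>2 div 9 ^ j)"
      by (simp add: field_simps)
  qed
  then have "1 / \<tau>\<^sup>2 - 1 \<le> real b" unfolding n2 by simp
  then have "1 - \<tau>\<^sup>2 \<le> real b * \<tau>\<^sup>2" using \<tau>0 by (simp add: field_simps)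
  moreover have "\<tau>\<^sup>2 \<le> (1 / 2)\<^sup>2" using \<tau> \<tau>0 by (intro power_mono) auto
  ultimately have b: "3 / 4 \<le> real b * \<tau>\<^sup>2" by (simp add: power2_eq_square)
  have "pi \<le> 3.15" using pi_approx by simp
  then have "pi\<^sup>2 \<le> 3.15\<^sup>2" by (intro power_mono) auto
  then have pi2: "pi\<^sup>2 \<le> 10" by (simp add: power2_eq_square)
  have "4 / 9 \<le> \<mu> ^ a"
  proof -
    have "1 - pi\<^sup>2 / 2 * (real a * \<tau>\<^sup>2) \<ge> 1 - 10 / 2 * (1 / 9)"
      using a pi2 by (intro diff_left_mono mult_mono) auto
    then have "4 / 9 \<le> 1 + real a * (\<mu> - 1) + real a * (1 - pi\<^sup>2 * \<tau>\<^sup>2 / 2 - \<mu>)"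
      by (simp add: algebra_simps)
    also have "\<dots> \<le> 1 + real a * (\<mu> - 1)"
      using lo by (simp add: mult_nonneg_nonpos)
    also have "\<dots> \<le> (1 + (\<mu> - 1)) ^ a" using \<mu>0 by (intro Bernoulli_inequality) auto
    finally show ?thesis by simp
  qed
  moreover have "\<mu> ^ b \<le> 6 / 25"
  proof -
    have "\<mu> \<le> exp (- 2 * \<tau>\<^sup>2)" using hi exp_ge_add_one_self[of "- 2 * \<tau>\<^sup>2"] by linarith
    then have "\<mu> ^ b \<le> exp (- 2 * \<tau>\<^sup>2) ^ b" using \<mu>0 by (rule power_mono)
    also have "\<dots> = exp (- (2 * (real b * \<tau>\<^sup>2)))" by (simp flip: exp_of_nat_mult)
    also have "\<dots> \<le> exp (- (3 / 2))" using b by simp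
    also have "\<dots> = 1 / exp (1 / 2) ^ 3" by (simp add: exp_minus inverse_eq_divide flip: exp_of_nat_mult)
    also have "\<dots> \<le> 1 / (1 + 1 / 2 + (1 / 2)\<^sup>2 / 2) ^ 3"
      by (intro divide_left_mono power_mono exp_lower_Taylor_quadratic mult_pos_pos zero_less_power)
         (auto intro: add_pos_nonneg)
    also have "\<dots> \<le> 6 / 25" by (simp add: eval_nat_numeral)
    finally show ?thesis .
  qed
  ultimately have "1 / 5 \<le> \<mu> ^ a - \<mu> ^ b" by simp
  then have "1 * (1 / 5) \<le> (1 + \<mu>) * (\<mu> ^ a - \<mu> ^ b)"
    using \<mu>0 by (intro mult_mono) auto
  then show ?thesis by (simp add: a_def b_def)
qed

lemma avg_pow_cos: "(avg ^^ w) (\<lambda>y. cos (\<theta> * of_int y + \<phi>)) x = cos \<theta> ^ w * cos (\<theta> * of_int x + \<phi>)"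
proof (induction w arbitrary: x)
  case (Suc w)
  have "cos (\<theta> * of_int (x - 1) + \<phi>) + cos (\<theta> * of_int (x + 1) + \<phi>) = 2 * cos \<theta> * cos (\<theta> * of_int x + \<phi>)"
    using cos_add[of "\<theta> * of_int x + \<phi>" \<theta>] cos_diff[of "\<theta> * of_int x + \<phi>" \<theta>]
    by (simp add: algebra_simps)
  then show ?case by (simp add: avg_def[of _ x] Suc flip: distrib_left)
qed simp

text \<open>
  The range of delays is shifted by 2 because \<open>response\<close> pairs the pattern at delay \<open>w + 2\<close> with \<open>P\<^sup>w\<close>.
\<close>

definition wave :: "nat \<Rightarrow> nat \<Rightarrow> real \<Rightarrow> real \<Rightarrow> nat \<times> int \<Rightarrow> real" where
  "wave a b \<theta> \<phi> = (\<lambda>(w, y). if a + 2 \<le> w \<and> w < b + 2 then cos (\<theta> * of_int y + \<phi>) else 0)"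

lemma response_wave:
  assumes "a \<le> b" "b + 2 \<le> t"
  shows "response t (wave a b \<theta> \<phi>) x
    = (1 + cos \<theta>) * (cos \<theta> ^ a - cos \<theta> ^ b) / 2 * cos (\<theta> * of_int x + \<phi>)"
proof -
  define C where "C = cos (\<theta> * of_int x + \<phi>)"
  define \<mu> where "\<mu> = cos \<theta>"
  have P: "(avg ^^ w) (\<lambda>y. wave a b \<theta> \<phi> (v, y)) x = (if a + 2 \<le> v \<and> v < b + 2 then \<mu> ^ w * C else 0)" for v w
    by (cases "a + 2 \<le> v \<and> v < b + 2") (auto simp: wave_def avg_pow_cos avg_pow_const C_def \<mu>_def)
  have "2 * response t (wave a b \<theta> \<phi>) x
      = (\<Sum>w<t. if a + 2 \<le> w + 2 \<and> w + 2 < b + 2 then \<mu> ^ w * C else 0)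
        - (\<Sum>w<t. if a + 2 \<le> w \<and> w < b + 2 then \<mu> ^ w * C else 0)"
    by (simp add: response_def avg_pow_diff P sum_subtractf del: add_2_eq_Suc')
  also have "(\<Sum>w<t. if a + 2 \<le> w + 2 \<and> w + 2 < b + 2 then \<mu> ^ w * C else 0) = (\<Sum>w\<in>{a..<b}. \<mu> ^ w * C)"
    by (rule sum.mono_neutral_cong_right) (use assms in auto)
  also have "(\<Sum>w<t. if a + 2 \<le> w \<and> w < b + 2 then \<mu> ^ w * C else 0) = (\<Sum>w\<in>{a+2..<b+2}. \<mu> ^ w * C)"
    by (rule sum.mono_neutral_cong_right) (use assms in auto)
  also have "\<dots> = (\<Sum>w\<in>{a..<b}. \<mu> ^ (w + 2) * C)"
    by (rule sum.shift_bounds_nat_ivl)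
  also have "(\<Sum>w\<in>{a..<b}. \<mu> ^ w * C) - (\<Sum>w\<in>{a..<b}. \<mu> ^ (w + 2) * C) = (1 + \<mu>) * (\<mu> ^ a - \<mu> ^ b) * C"
    using assms(1) by (induction b rule: nat_induct_at_least) (simp_all add: algebra_simps)
  finally show ?thesis by (simp add: C_def \<mu>_def)
qed

text \<open>
  Shifting by \<open>n\<close> changes the phase by an odd multiple of \<open>\<pi>\<close>, so the contributions from the two end points of
  the interval reinforce each other.
\<close>

lemma pattern_disc_wave:
  fixes j :: nat
  assumes "a \<le> b" "b + 2 \<le> t" "n > 0"
  defines "\<theta> \<equiv> pi * 3 ^ j / real n"
  shows "pattern_disc t n (wave a b \<theta> \<phi>) x
    = (1 + cos \<theta>) * (cos \<theta> ^ a - cos \<theta> ^ b) / 2 * cos (\<theta> * of_int x + \<phi>)"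
proof -
  have "\<theta> * of_int (x + int n) + \<phi> = (\<theta> * of_int x + \<phi>) + of_nat (3 ^ j) * pi"
    using assms(3) by (simp add: \<theta>_def field_simps)
  then have "cos (\<theta> * of_int (x + int n) + \<phi>) = - cos (\<theta> * of_int x + \<phi>)"
    by (simp only: cos_add cos_npi sin_npi) simp
  then show ?thesis
    unfolding pattern_disc_def response_wave[OF assms(1,2)] by simp
qed

text \<open>
  In the average over the four phases \<open>0, \<pi>/2, \<pi>, 3\<pi>/2\<close> the cross terms with \<open>S\<close> cancel, and the squares of
  cosine and sine add up to a constant at every position.
\<close>

lemma exists_phase:
  fixes S \<psi> :: "int \<Rightarrow> real" and A :: real
  shows "\<exists>\<phi>. (\<Sum>b\<in>K. (S b + A * cos (\<psi> b + \<phi>))\<^sup>2) \<ge> (\<Sum>b\<in>K. (S b)\<^sup>2) + A\<^sup>2 / 2 * real (card K)"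
proof -
  define F where "F \<phi> = (\<Sum>b\<in>K. (S b + A * cos (\<psi> b + \<phi>))\<^sup>2)" for \<phi>
  have shifts: "cos (x + 0) = cos x" "cos (x + pi) = - cos x"
    "cos (x + pi / 2) = - sin x" "cos (x + (pi / 2 + pi)) = sin x" for x :: real
    by (simp_all only: cos_add sin_add cos_pi_half sin_pi_half cos_pi sin_pi) simp_all
  have expand: "(p + A * c)\<^sup>2 + (p + A * - c)\<^sup>2 + (p + A * - s)\<^sup>2 + (p + A * s)\<^sup>2
      = 4 * p\<^sup>2 + 2 * A\<^sup>2 * (s\<^sup>2 + c\<^sup>2)" for p c s :: real
    by (simp add: power2_eq_square algebra_simps)
  have "F 0 + F pi + F (pi / 2) + F (pi / 2 + pi)
      = (\<Sum>b\<in>K. 4 * (S b)\<^sup>2 + 2 * A\<^sup>2 * ((sin (\<psi> b))\<^sup>2 + (cos (\<psi> b))\<^sup>2))"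
    unfolding F_def sum.distrib[symmetric]
    by (rule sum.cong[OF refl]) (simp only: shifts expand)
  also have "\<dots> = 4 * ((\<Sum>b\<in>K. (S b)\<^sup>2) + A\<^sup>2 / 2 * real (card K))"
    by (simp add: sum.distrib sum_distrib_left)
  finally have "\<exists>\<phi>. F \<phi> \<ge> (\<Sum>b\<in>K. (S b)\<^sup>2) + A\<^sup>2 / 2 * real (card K)"
    by (smt (verit))
  then show ?thesis by (simp add: F_def)
qed

text \<open>
  The scales are added one by one. That \<open>r\<close> vanishes at the delays below the current range leaves room for the next
  wave, so the values stay in \<open>[-1, 1]\<close>.
\<close>

lemma superposed_waves:
  fixes K :: "int set"
  assumes t: "t = n\<^sup>2 + 2" and J: "\<forall>j<J. 2 * 3 ^ j \<le> n"
  shows "\<exists>r. (\<forall>i. \<bar>r i\<bar> \<le> 1) \<and> (\<forall>w y. w < n\<^sup>2 div 9 ^ J + 2 \<longrightarrow> r (w, y) = 0) \<and>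
    real J * real (card K) / 200 \<le> (\<Sum>b\<in>K. (pattern_disc t n r b)\<^sup>2)"
  using J
proof (induction J)
  case 0
  show ?case by (rule exI[of _ "\<lambda>_. 0"]) (simp add: sum_nonneg)
next
  case (Suc J)
  then have "\<forall>j<J. 2 * 3 ^ j \<le> n" by simp
  from Suc.IH[OF this] obtain r where r: "\<And>i. \<bar>r i\<bar> \<le> 1" "\<And>w y. w < n\<^sup>2 div 9 ^ J + 2 \<Longrightarrow> r (w, y) = 0"
    "real J * real (card K) / 200 \<le> (\<Sum>b\<in>K. (pattern_disc t n r b)\<^sup>2)"
    by blast
  have J: "2 * 3 ^ J \<le> n" using Suc.prems by simp
  then have n: "n > 0" by (cases n) auto
  define a where "a = n\<^sup>2 div 9 ^ Suc J"
  define b where "b = n\<^sup>2 div 9 ^ J"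
  have ab: "a \<le> b" unfolding a_def b_def by (intro div_le_mono2) auto
  have bt: "b + 2 \<le> t" by (simp add: b_def t)
  define \<theta> where "\<theta> = pi * 3 ^ J / real n"
  define A where "A = (1 + cos \<theta>) * (cos \<theta> ^ a - cos \<theta> ^ b) / 2"
  have A: "1 / 10 \<le> A"
    unfolding A_def \<theta>_def a_def b_def by (rule amplitude_lower_bound[OF J])
  obtain \<phi> where \<phi>: "(\<Sum>x\<in>K. (pattern_disc t n r x)\<^sup>2) + A\<^sup>2 / 2 * real (card K)
      \<le> (\<Sum>x\<in>K. (pattern_disc t n r x + A * cos (\<theta> * of_int x + \<phi>))\<^sup>2)"
    using exists_phase[where K = K and S = "pattern_disc t n r" and A = A and \<psi> = "\<lambda>x. \<theta> * of_int x"] by blast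
  define r' where "r' i = 1 * r i + 1 * wave a b \<theta> \<phi> i" for i
  have "pattern_disc t n r' x = pattern_disc t n r x + A * cos (\<theta> * of_int x + \<phi>)" for x
    unfolding r'_def pattern_disc_linear A_def \<theta>_def
    by (subst pattern_disc_wave[OF ab bt n]) simp
  then have "(\<Sum>x\<in>K. (pattern_disc t n r x)\<^sup>2) + A\<^sup>2 / 2 * real (card K)
      \<le> (\<Sum>x\<in>K. (pattern_disc t n r' x)\<^sup>2)" using \<phi> by simp
  moreover have "1 / 200 * real (card K) \<le> A\<^sup>2 / 2 * real (card K)"
    using power_mono[OF A, of 2] by (intro mult_right_mono) (auto simp: power2_eq_square)
  ultimately have "real (Suc J) * real (card K) / 200 \<le> (\<Sum>x\<in>K. (pattern_disc t n r' x)\<^sup>2)"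
    using r(3) by (simp add: field_simps)
  moreover have "\<bar>r' i\<bar> \<le> 1" for i
    using r(1)[of i] r(2)[of "fst i" "snd i"]
    by (cases i) (auto simp: r'_def wave_def b_def)
  moreover have "r' (w, y) = 0" if "w < n\<^sup>2 div 9 ^ Suc J + 2" for w y
  proof -
    have "w < b + 2" using that ab by (simp add: a_def)
    then show ?thesis using that r(2)[of w y] by (auto simp: r'_def wave_def a_def b_def)
  qed
  ultimately show ?case by blast
qed

text \<open>
  The parity of \<open>b\<close> is such that \<open>b\<close> can carry chips at time \<open>t - 1\<close>. In the formula for an interval, the
  values at \<open>b - 1\<close> and at one of the two positions at the right end then vanish by parity, and those at \<open>b\<close>
  and \<open>b + 2 (L div 2)\<close> remain.
\<close>

lemma DISC_eq_pattern_disc: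
  assumes a0: "arrows a0" and f0: "even_config f0" and parity: "even (b - int t + 1)"
    and r: "\<And>w y. w \<le> t + 1 \<Longrightarrow> \<bar>y - b\<bar> \<le> int t + int L \<Longrightarrow> even (y - b - int w) \<Longrightarrow>
              r (w, y) = of_int (arrow f0 a0 y (t + 1 - w))"
  shows "DISC f0 a0 {b..<b + int L} t = pattern_disc t (2 * (L div 2)) r b"
proof -
  have f0': "parity_config 0 f0" using f0 by (simp add: even_config_def parity_config_def)
  define G where "G z = (\<Sum>w<t. (avg ^^ w) (flow f0 a0 (t - 1 - w)) z)" for z
  have G_odd: "G x = 0" if "odd (x - b)" for x
  proof -
    have "(avg ^^ w) (flow f0 a0 (t - 1 - w)) x = (avg ^^ w) (\<lambda>_. 0) x" if w: "w < t" for w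
    proof (rule avg_pow_cong)
      fix y assume "even (y - x - int w)"
      then have "odd (y - int (t - 1 - w) - 0)"
        using \<open>odd (x - b)\<close> parity w by (simp add: of_nat_diff) presburger
      then show "flow f0 a0 (t - 1 - w) y = 0"
        using chips_parity[OF f0'] by (simp add: flow_def)
    qed
    then show ?thesis by (simp add: G_def avg_pow_const)
  qed
  have G_even: "G x = response t r x" if x: "even (x - b)" "\<bar>x - b\<bar> \<le> int L" for x
  proof -
    have "G x = response t (\<lambda>(w, y). reversed_arrow 0 f0 a0 t w y) x"
      using flow_sum_eq[OF f0', of t t a0 x] by (simp add: G_def response_def)
    also have "\<dots> = response t r x"
    proof (rule response_cong)
      fix w y assume w: "w \<le> t + 1" and y: "\<bar>y - x\<bar> \<le> int t" "even (y - x - int w)"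
      have "even (y - int (t + 1 - w) - 0)"
        using y(2) x(1) parity w by (simp add: of_nat_diff) presburger
      moreover have "\<bar>y - b\<bar> \<le> int t + int L" using x(2) y(1) by linarith
      moreover have "even (y - b - int w)" using x(1) y(2) by presburger
      ultimately have "even (y - int (t + 1 - w) - 0)" "r (w, y) = of_int (arrow f0 a0 y (t + 1 - w))"
        using r[OF w] by auto
      then show "(case (w, y) of (w, y) \<Rightarrow> reversed_arrow 0 f0 a0 t w y) = r (w, y)"
        using w by (simp only: reversed_arrow_def active_arrow_def prod.case if_True)
    qed
    finally show ?thesis .
  qed
  have "DISC f0 a0 {b..<b + int L} t = (G b + G (b - 1) - G (b + int L) - G (b + int L - 1)) / 2"
    unfolding DISC_interval[OF a0] G_def[symmetric] sum_central_diff_interval by (simp add: field_simps)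
  also have "\<dots> = (G b - G (b + int (2 * (L div 2)))) / 2"
  proof (cases "even L")
    case True
    moreover from this have "G (b + int L - 1) = 0" "G (b - 1) = 0" by (auto intro: G_odd)
    ultimately show ?thesis by simp
  next
    case False
    then have "b + int L - 1 = b + int (2 * (L div 2))" by presburger
    moreover have "G (b + int L) = 0" "G (b - 1) = 0" using False by (auto intro: G_odd)
    ultimately show ?thesis by (simp only: add_0_right diff_0_right)
  qed
  also have "\<dots> = pattern_disc t (2 * (L div 2)) r b"
    unfolding pattern_disc_def by (subst (1 2) G_even) auto
  finally show ?thesis .
qed

text \<open>
  Only finitely many arrows influence the intervals that start in \<open>K\<close>, so the superposition of waves can be rounded
  to signs.
\<close>

lemma exists_arrow_pattern:
  fixes K :: "int set"
  assumes t: "t = n\<^sup>2 + 2" and J: "\<forall>j<J. 2 * 3 ^ j \<le> n"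
    and K: "K \<subseteq> {lo..hi}"
  shows "\<exists>r. (\<forall>i. r i \<in> {-1, 1}) \<and> real J * real (card K) / 200 \<le> (\<Sum>b\<in>K. (pattern_disc t n r b)\<^sup>2)"
proof -
  obtain r where r: "\<And>i. \<bar>r i\<bar> \<le> 1"
    "real J * real (card K) / 200 \<le> (\<Sum>b\<in>K. (pattern_disc t n r b)\<^sup>2)"
    using superposed_waves[OF t J] by blast
  define I where "I = {0..t + 1} \<times> {lo - int t..hi + int t + int n}"
  obtain r' where r': "\<forall>i\<in>I. r' i \<in> {-1, 1}"
    "(\<Sum>b\<in>K. (pattern_disc t n r b)\<^sup>2) \<le> (\<Sum>b\<in>K. (pattern_disc t n r' b)\<^sup>2)"
    using round_to_signs[of I "\<lambda>r. \<Sum>b\<in>K. (pattern_disc t n r b)\<^sup>2" r] pattern_disc_round r(1)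
    by (auto simp: I_def)
  define r'' where "r'' i = (if i \<in> I then r' i else 1)" for i
  have "pattern_disc t n r'' b = pattern_disc t n r' b" if "b \<in> K" for b
  proof -
    have b: "lo \<le> b" "b \<le> hi" using that K by auto
    have "response t r'' x = response t r' x" if "x \<in> {b, b + int n}" for x
      by (rule response_cong) (use that b in \<open>auto simp: r''_def I_def\<close>)
    then show ?thesis by (simp add: pattern_disc_def)
  qed
  then have "(\<Sum>b\<in>K. (pattern_disc t n r'' b)\<^sup>2) = (\<Sum>b\<in>K. (pattern_disc t n r' b)\<^sup>2)"
    by simp
  moreover have "r'' i \<in> {-1, 1}" for i using r'(1) by (simp add: r''_def)
  ultimately show ?thesis using r(2) r'(2) by (intro exI[of _ r'']) auto
qed

lemma ln_le_number_of_scales: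
  fixes L :: nat
  assumes "L \<ge> 2" "2 * (L div 2) < 2 * 3 ^ J"
  shows "ln (real L) \<le> 5 * real J"
proof -
  have "J \<noteq> 0" using assms by (intro notI) auto
  then have "2 * 3 ^ J \<le> (6 :: nat) ^ J"
  proof (induction J)
    case (Suc J)
    then show ?case by (cases "J = 0") auto
  qed simp
  moreover have "L \<le> 2 * 3 ^ J" using assms by presburger
  ultimately have "L \<le> 6 ^ J" by simp
  then have "real L \<le> real (6 ^ J)" by (simp only: of_nat_le_iff)
  then have "ln (real L) \<le> ln (6 ^ J)"
    using assms(1) by simp
  also have "\<dots> = real J * ln 6" by (simp add: ln_realpow)
  also have "\<dots> \<le> real J * 5"
    using ln_le_minus_one[of 6] by (intro mult_left_mono) auto
  finally show ?thesis by simp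
qed

text \<open>
  Only the odd shifts \<open>k\<close> are used; they put the start of the interval on the parity class required by
  \<open>DISC_eq_pattern_disc\<close>, and they make up at least half of all shifts. The interval starts at \<open>t\<close> so that all
  arrows that matter lie to the right of \<open>- L\<close>.
\<close>

theorem discrepancy_second_moment_lower_bound:
  assumes L: "L \<ge> 2" and M: "M \<ge> 1"
  shows "\<exists>f0 a0 t X. arrows a0 \<and> even_config f0 \<and> interval_of_length L X \<and>
    ln (real L) / 2000 \<le> 1 / real M * (\<Sum>k = 1..M. (DISC f0 a0 (translate X (int k)) t)\<^sup>2)"
proof -
  define n where "n = 2 * (L div 2)"
  define t where "t = n\<^sup>2 + 2"
  define S where "S = {k \<in> {1..M}. odd k}"
  define K where "K = (\<lambda>k. int t + int k) ` S"
  have finS: "finite S" by (simp add: S_def)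
  have inj: "inj_on (\<lambda>k. int t + int k) S" by (auto simp: inj_on_def)
  have cardK: "real M \<le> 2 * real (card K)"
  proof -
    have "(\<lambda>i. 2 * i + 1) ` {..<(M + 1) div 2} \<subseteq> S" by (auto simp: S_def)
    from card_mono[OF finS this] have "(M + 1) div 2 \<le> card S"
      by (subst (asm) card_image) (auto simp: inj_on_def)
    then have "M \<le> 2 * card S" by linarith
    then show ?thesis by (simp add: K_def card_image[OF inj])
  qed
  define J where "J = (LEAST J. n < 2 * 3 ^ J)"
  have "n < 2 * 3 ^ n" using less_exp[of n] power_mono[of 2 "3::nat" n] by linarith
  then have J: "n < 2 * 3 ^ J" unfolding J_def by (rule LeastI)
  have J': "\<forall>j<J. 2 * 3 ^ j \<le> n"
    unfolding J_def using not_less_Least by (metis not_le)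
  have "K \<subseteq> {int t + 1..int t + int M}" by (auto simp: K_def S_def Suc_le_eq)
  from exists_arrow_pattern[OF t_def J' this] obtain r where r: "\<And>i. r i \<in> {-1, 1}"
    "real J * real (card K) / 200 \<le> (\<Sum>b\<in>K. (pattern_disc t n r b)\<^sup>2)" by blast
  define \<rho> :: "nat \<Rightarrow> int \<Rightarrow> int" where "\<rho> s y = (if r (t + 1 - s, y) = 1 then 1 else -1)" for s y
  have "\<rho> s y \<in> {-1, 1}" for s y by (simp add: \<rho>_def)
  then obtain f0 a0 where a0: "arrows a0" and f0: "even_config f0"
    and arrow: "\<And>s y. s \<le> t + 1 \<Longrightarrow> y \<ge> - int L \<Longrightarrow> even (y - int s) \<Longrightarrow> arrow f0 a0 y s = \<rho> s y"
    using arrow_forcing[of \<rho> "t + 1" "- int L"] by blast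
  define X where "X = {int t..<int t + int L}"
  have DISC: "DISC f0 a0 (translate X (int k)) t = pattern_disc t n r (int t + int k)" if "k \<in> S" for k
    unfolding X_def translate_interval n_def
  proof (rule DISC_eq_pattern_disc[OF a0 f0])
    show "even (int t + int k - int t + 1)" using that by (simp add: S_def)
    fix w y assume w: "w \<le> t + 1" and y: "\<bar>y - (int t + int k)\<bar> \<le> int t + int L"
      "even (y - (int t + int k) - int w)"
    have "arrow f0 a0 y (t + 1 - w) = \<rho> (t + 1 - w) y"
    proof (rule arrow)
      show "even (y - int (t + 1 - w))"
        using y(2) w that by (simp add: of_nat_diff S_def) presburger
    qed (use y in auto)
    then show "r (w, y) = of_int (arrow f0 a0 y (t + 1 - w))"
      using r(1)[of "(w, y)"] w by (auto simp: \<rho>_def)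
  qed
  have "ln (real L) / 2000 * real M \<le> (5 * real J) / 2000 * (2 * real (card K))"
    using ln_le_number_of_scales[OF L, of J] J cardK L unfolding n_def
    by (intro mult_mono divide_right_mono) auto
  also have "\<dots> = real J * real (card K) / 200" by simp
  also have "\<dots> \<le> (\<Sum>b\<in>K. (pattern_disc t n r b)\<^sup>2)" by (rule r(2))
  also have "\<dots> = (\<Sum>k\<in>S. (DISC f0 a0 (translate X (int k)) t)\<^sup>2)"
    unfolding K_def by (subst sum.reindex[OF inj]) (simp add: DISC)
  also have "\<dots> \<le> (\<Sum>k = 1..M. (DISC f0 a0 (translate X (int k)) t)\<^sup>2)"
    by (rule sum_mono2) (auto simp: S_def)
  finally have "ln (real L) / 2000 \<le> 1 / real M * (\<Sum>k = 1..M. (DISC f0 a0 (translate X (int k)) t)\<^sup>2)"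
    using M by (simp add: field_simps)
  then show ?thesis
    using a0 f0 by (intro exI[of _ f0] exI[of _ a0] exI[of _ t] exI[of _ X])
      (auto simp: interval_of_length_def X_def)
qed

theorem theorem12:
  shows "\<exists>C c :: real. C > 0 \<and> c > 0 \<and>
    (\<forall>L::nat. L \<ge> 2 \<longrightarrow>
      (\<exists>M0::nat. M0 \<ge> 1 \<and>
        (\<forall>M::nat. M \<ge> M0 \<longrightarrow>
          (\<forall>f0 a0 t X. arrows a0 \<and> (even_config f0 \<or> odd_config f0) \<and> interval_of_length L X \<longrightarrow>
            1 / real M * (\<Sum>k = 1..M. (DISC f0 a0 (translate X (int k)) t)\<^sup>2)
              \<le> C * ln (real L))))) \<and>
    (\<forall>L M :: nat. L \<ge> 1 \<and> M \<ge> 1 \<longrightarrow>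
      (\<exists>f0 a0 t X. arrows a0 \<and> even_config f0 \<and> interval_of_length L X \<and>
        1 / real M * (\<Sum>k = 1..M. (DISC f0 a0 (translate X (int k)) t)\<^sup>2)
          \<ge> c * ln (real L)))"
proof (rule exI[of _ 1680], rule exI[of _ "1 / 2000"], intro conjI allI impI)
  fix L :: nat assume L: "L \<ge> 2"
  have parity: "\<exists>e. parity_config e f0" if "even_config f0 \<or> odd_config f0" for f0
    using that
  proof
    assume "even_config f0"
    then have "parity_config 0 f0" by (simp add: even_config_def parity_config_def)
    then show ?thesis ..
  next
    assume "odd_config f0"
    then have "parity_config 1 f0" by (simp add: odd_config_def parity_config_def)
    then show ?thesis ..
  qed
  show "\<exists>M0::nat. M0 \<ge> 1 \<and>
        (\<forall>M::nat. M \<ge> M0 \<longrightarrow>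
          (\<forall>f0 a0 t X. arrows a0 \<and> (even_config f0 \<or> odd_config f0) \<and> interval_of_length L X \<longrightarrow>
            1 / real M * (\<Sum>k = 1..M. (DISC f0 a0 (translate X (int k)) t)\<^sup>2) \<le> 1680 * ln (real L)))"
  proof (intro exI[of _ "L\<^sup>2"] conjI allI impI)
    show "1 \<le> L\<^sup>2" using L by simp
  next
    fix M f0 a0 t X
    assume M: "L\<^sup>2 \<le> M"
      and asm: "arrows a0 \<and> (even_config f0 \<or> odd_config f0) \<and> interval_of_length L X"
    obtain e where "parity_config e f0" using parity asm by blast
    then show "1 / real M * (\<Sum>k = 1..M. (DISC f0 a0 (translate X (int k)) t)\<^sup>2) \<le> 1680 * ln (real L)"
      using discrepancy_second_moment_upper_bound[OF L M] asm by blast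
  qed
next
  fix L M :: nat assume LM: "L \<ge> 1 \<and> M \<ge> 1"
  show "\<exists>f0 a0 t X. arrows a0 \<and> even_config f0 \<and> interval_of_length L X \<and>
        1 / real M * (\<Sum>k = 1..M. (DISC f0 a0 (translate X (int k)) t)\<^sup>2) \<ge> 1 / 2000 * ln (real L)"
  proof (cases "L = 1")
    case True
    have X: "interval_of_length L {0..<1}"
      unfolding interval_of_length_def True by (rule exI[of _ 0]) simp
    show ?thesis
      by (rule exI[of _ "\<lambda>_. 0"], rule exI[of _ "\<lambda>_. 1"], rule exI[of _ 0], rule exI[of _ "{0..<1}"])
         (use X in \<open>simp add: True arrows_def even_config_def sum_nonneg\<close>)
  next
    case False
    then show ?thesis
      using discrepancy_second_moment_lower_bound[of L M] LM by simp
  qed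
qed auto

end
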